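(* For every $\varepsilon>0$ there exist a constant $c>0$ and constants $0<c_1\le c_2$ such that for every integer $n\ge 2$ and every admissible sign function $\sigma$ on the arcs of $G=K_{n+1}$, with marked subgraph $\Gamma$, satisfying $$\frac{|V(\Gamma)|}{|V(G)|}+\frac{|E(\Gamma)|}{|E(G)|}<c,$$ the quantum searching time $t_f$ is of the order of $n/\sqrt{|E(\Gamma)|}$, i.e. $c_1\, n/\sqrt{|E(\Gamma)|}\le t_f\le c_2\, n/\sqrt{|E(\Gamma)|}$, and the finding probability satisfies $FP\ge 1-\varepsilon$.
   Context: Let $n\ge 2$ and $G=K_{n+1}$, with arc set $\mathcal{A}(G)=\{(u,v): uv\in E(G)\}$; for $a=(u,v)$ write $o(a)=u$, $t(a)=v$, $a^{-1}=(v,u)$. An admissible sign function is a map $\sigma:\mathcal{A}(G)\to\{\pm1\}$ such that $\sigma(a^{-1})=1$ whenever $\sigma(a)=-1$, and such that at least one edge is marked, where, with $\tau(uv)=\sigma((u,v))\sigma((v,u))$, an edge $e$ is called marked if $\tau(e)=-1$. The marked subgraph $\Gamma$ is the subgraph of $G$ whose edge set is the set of marked edges and whose vertex set is the set of endpoints of marked edges; $\mathcal{A}(\Gamma)=\{(u,v):uv\in E(\Gamma)\}$. Let $S$ be the matrix indexed by $\mathcal{A}(G)$ with $S_{a,b}=1$ if $a=b^{-1}$ and $0$ otherwise. Let $d_\sigma$ be the $V(G)\times\mathcal{A}(G)$ matrix with $(d_\sigma)_{v,a}=\sigma(a)/\sqrt{n}$ if $t(a)=v$ and $0$ otherwise,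 and $d_\sigma^*$ its (conjugate) transpose. The time evolution operator is $U_\sigma=S(2d_\sigma^*d_\sigma-I)$. Put $T_\Gamma=d_\sigma S d_\sigma^*$, i.e. the symmetric matrix indexed by $V(G)$ with zero diagonal and $(T_\Gamma)_{u,v}=\tau(uv)/n$ for $u\ne v$. Let $\lambda_{\max}(T_\Gamma)$ be its largest eigenvalue and $\theta_{\max}=\arccos(\lambda_{\max}(T_\Gamma))$ (one has $\theta_{\max}>0$ whenever $|V(\Gamma)|\le n$). The quantum searching time is $t_f=\lfloor \pi/(2\theta_{\max})\rfloor$. Let $\mathbf{j}=\mathbf{j}_{\mathcal{A}(G)}$ be the normalized (unit Euclidean length) all-ones vector indexed by $\mathcal{A}(G)$. The finding probability is $FP=\big\|(U_\sigma^{t_f}\mathbf{j})|_{\mathcal{A}(\Gamma)}\big\|_2^2$, where $|_{\mathcal{A}(\Gamma)}$ denotes restriction of the vector to the coordinates in $\mathcal{A}(\Gamma)$. *)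

theory Defs
  imports Complex_Main "Jordan_Normal_Form.Char_Poly"
begin

text \<open>The complete graph \<open>K\<^sub>n\<^sub>+\<^sub>1\<close> lives on the vertex set \<open>{0..n}\<close>. Edges are two-element sets of
  vertices, arcs are ordered pairs.\<close>

definition verts :: "nat \<Rightarrow> nat set" where
  "verts n = {0..n}"

definition edges :: "nat \<Rightarrow> nat set set" where
  "edges n = {{u, v} | u v. u \<in> verts n \<and> v \<in> verts n \<and> u \<noteq> v}"

definition arcs :: "nat \<Rightarrow> (nat \<times> nat) set" where
  "arcs n = {(u, v). {u, v} \<in> edges n}"

definition arc_origin :: "nat \<times> nat \<Rightarrow> nat" where
  "arc_origin a = fst a"

definition arc_target :: "nat \<times> nat \<Rightarrow> nat" where
  "arc_target a = snd a"

definition arc_inv :: "nat \<times> nat \<Rightarrow> nat \<times> nat" where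
  "arc_inv a = (arc_target a, arc_origin a)"

definition edge_sign :: "(nat \<times> nat \<Rightarrow> real) \<Rightarrow> nat \<Rightarrow> nat \<Rightarrow> real" where
  "edge_sign \<sigma> u v = \<sigma> (u, v) * \<sigma> (v, u)"

definition marked_edges :: "nat \<Rightarrow> (nat \<times> nat \<Rightarrow> real) \<Rightarrow> nat set set" where
  "marked_edges n \<sigma> = {{u, v} | u v. {u, v} \<in> edges n \<and> edge_sign \<sigma> u v = -1}"

definition marked_verts :: "nat \<Rightarrow> (nat \<times> nat \<Rightarrow> real) \<Rightarrow> nat set" where
  "marked_verts n \<sigma> = \<Union> (marked_edges n \<sigma>)"

definition marked_arcs :: "nat \<Rightarrow> (nat \<times> nat \<Rightarrow> real) \<Rightarrow> (nat \<times> nat) set" where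
  "marked_arcs n \<sigma> = {(u, v). {u, v} \<in> marked_edges n \<sigma>}"

text \<open>A sign function is a total function of which only the values on \<^term>\<open>arcs n\<close> matter.\<close>

definition admissible :: "nat \<Rightarrow> (nat \<times> nat \<Rightarrow> real) \<Rightarrow> bool" where
  "admissible n \<sigma> \<longleftrightarrow>
     (\<forall>a \<in> arcs n. \<sigma> a = 1 \<or> \<sigma> a = -1) \<and>
     (\<forall>a \<in> arcs n. \<sigma> a = -1 \<longrightarrow> \<sigma> (arc_inv a) = 1) \<and>
     marked_edges n \<sigma> \<noteq> {}"

text \<open>Library matrices are indexed by initial segments of the naturals. Vertices index themselves
  (\<open>0, \<dots>, n\<close>); arcs are indexed by their position in a fixed enumeration.\<close>

definition arc_list :: "nat \<Rightarrow> (nat \<times> nat) list" where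
  "arc_list n = filter (\<lambda>(u, v). u \<noteq> v) (List.product [0..<Suc n] [0..<Suc n])"

lemma set_arc_list: "set (arc_list n) = arcs n"
proof -
  have "(u, v) \<in> arcs n \<longleftrightarrow> u \<le> n \<and> v \<le> n \<and> u \<noteq> v" for u v
    unfolding arcs_def edges_def verts_def by (auto simp: doubleton_eq_iff)
  then show ?thesis
    unfolding arc_list_def by (auto simp: less_Suc_eq_le simp del: upt_Suc)
qed

lemma distinct_arc_list: "distinct (arc_list n)"
  by (simp add: arc_list_def distinct_product)

definition num_arcs :: "nat \<Rightarrow> nat" where
  "num_arcs n = length (arc_list n)"

definition shift_mat :: "nat \<Rightarrow> real mat" where
  "shift_mat n = mat (num_arcs n) (num_arcs n)
     (\<lambda>(i, j). if arc_list n ! i = arc_inv (arc_list n ! j) then 1 else 0)"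

definition boundary_mat :: "nat \<Rightarrow> (nat \<times> nat \<Rightarrow> real) \<Rightarrow> real mat" where
  "boundary_mat n \<sigma> = mat (Suc n) (num_arcs n)
     (\<lambda>(v, i). if arc_target (arc_list n ! i) = v then \<sigma> (arc_list n ! i) / sqrt (real n) else 0)"

definition evolution_mat :: "nat \<Rightarrow> (nat \<times> nat \<Rightarrow> real) \<Rightarrow> real mat" where
  "evolution_mat n \<sigma> = shift_mat n *
     (2 \<cdot>\<^sub>m (transpose_mat (boundary_mat n \<sigma>) * boundary_mat n \<sigma>) - 1\<^sub>m (num_arcs n))"

definition discriminant_mat :: "nat \<Rightarrow> (nat \<times> nat \<Rightarrow> real) \<Rightarrow> real mat" where
  "discriminant_mat n \<sigma> = boundary_mat n \<sigma> * shift_mat n * transpose_mat (boundary_mat n \<sigma>)"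

lemma sum_arc_list: "(\<Sum>i<num_arcs n. f (arc_list n ! i)) = (\<Sum>a\<in>arcs n. f a)"
  unfolding num_arcs_def set_arc_list[symmetric]
  using sum.reindex_bij_betw[OF bij_betw_nth[OF distinct_arc_list refl refl]] .

lemma discriminant_mat_entry:
  assumes "u \<le> n" "v \<le> n"
  shows "discriminant_mat n \<sigma> $$ (u, v) = (if u = v then 0 else edge_sign \<sigma> u v / real n)"
proof -
  define d where "d w a = (if arc_target a = w then \<sigma> a / sqrt (real n) else 0)" for w a
  define s where "s a b = (if a = arc_inv b then 1 else 0 :: real)" for a b
  have arcs_iff: "(x, y) \<in> arcs n \<longleftrightarrow> x \<le> n \<and> y \<le> n \<and> x \<noteq> y" for x y
    unfolding arcs_def edges_def verts_def by (auto simp: doubleton_eq_iff)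
  have fin: "finite (arcs n)" unfolding set_arc_list[symmetric] by simp
  have inv_arcs: "arc_inv b \<in> arcs n" if "b \<in> arcs n" for b
    using that by (cases b) (auto simp: arc_inv_def arc_target_def arc_origin_def arcs_iff)
  have "discriminant_mat n \<sigma> $$ (u, v) =
      (\<Sum>j<num_arcs n. (\<Sum>i<num_arcs n. d u (arc_list n ! i) * s (arc_list n ! i) (arc_list n ! j))
         * d v (arc_list n ! j))"
    using assms unfolding discriminant_mat_def boundary_mat_def shift_mat_def d_def s_def
    by (simp add: scalar_prod_def atLeast0LessThan)
  also have "\<dots> = (\<Sum>b\<in>arcs n. (\<Sum>a\<in>arcs n. d u a * s a b) * d v b)"
    by (simp only: sum_arc_list[of "\<lambda>a. d u a * s a b" for b]
          sum_arc_list[of "\<lambda>b. (\<Sum>a\<in>arcs n. d u a * s a b) * d v b"])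
  also have "\<dots> = (\<Sum>b\<in>arcs n. d u (arc_inv b) * d v b)"
    by (intro sum.cong refl) (simp add: s_def fin inv_arcs if_distrib cong: if_cong)
  also have "\<dots> = (\<Sum>b\<in>arcs n. if b = (u, v) then edge_sign \<sigma> u v / real n else 0)"
    by (intro sum.cong refl)
      (auto simp: d_def arc_inv_def arc_target_def arc_origin_def edge_sign_def)
  also have "\<dots> = (if u = v then 0 else edge_sign \<sigma> u v / real n)"
    using assms by (simp add: fin arcs_iff)
  finally show ?thesis .
qed

definition lambda_max :: "nat \<Rightarrow> (nat \<times> nat \<Rightarrow> real) \<Rightarrow> real" where
  "lambda_max n \<sigma> = Max {x. eigenvalue (discriminant_mat n \<sigma>) x}"

definition theta_max :: "nat \<Rightarrow> (nat \<times> nat \<Rightarrow> real) \<Rightarrow> real" where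
  "theta_max n \<sigma> = arccos (lambda_max n \<sigma>)"

definition search_time :: "nat \<Rightarrow> (nat \<times> nat \<Rightarrow> real) \<Rightarrow> nat" where
  "search_time n \<sigma> = nat \<lfloor>pi / (2 * theta_max n \<sigma>)\<rfloor>"

definition uniform_vec :: "nat \<Rightarrow> real vec" where
  "uniform_vec n = vec (num_arcs n) (\<lambda>_. 1 / sqrt (real (num_arcs n)))"

definition finding_prob :: "nat \<Rightarrow> (nat \<times> nat \<Rightarrow> real) \<Rightarrow> real" where
  "finding_prob n \<sigma> =
     (\<Sum>i | i < num_arcs n \<and> arc_list n ! i \<in> marked_arcs n \<sigma>.
        (((evolution_mat n \<sigma> ^\<^sub>m search_time n \<sigma>) *\<^sub>v uniform_vec n) $ i)\<^sup>2)"

end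

theory Submission
  imports Defs "HOL-Analysis.Function_Topology"
begin

text \<open>
  Writing an eigenfunction \<open>f\<close> of the discriminant for \<open>\<lambda>\<^sub>m\<^sub>a\<^sub>x = cos \<theta>\<close> so that it equals \<open>1\<close> off the
  marked vertices, the eigenvalue equation forces \<open>\<bar>1 - f u\<bar> = O(deg u / n)\<close>, where \<open>deg\<close> is the
  degree in the marked graph, and summing it over all vertices gives \<open>1 - \<lambda>\<^sub>m\<^sub>a\<^sub>x\<close> of order
  \<open>m / n\<^sup>2\<close> with \<open>m\<close> the number of marked edges; hence \<open>\<theta>\<close> is of order \<open>sqrt m / n\<close>. The
  vectors \<open>a (u, v) = \<sigma> (u, v) * f v\<close> and \<open>b (u, v) = \<sigma> (v, u) * f u\<close> span a plane on which the
  walk acts by \<open>a \<mapsto> b \<mapsto> 2 cos \<theta> b - a\<close>. In this plane \<open>t\<close> steps carry \<open>(a + b) / 2\<close>, which is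
  close to the uniform vector, to
  \<open>cos (t \<theta>) (a + b) / 2 + sin (t \<theta>) cot (\<theta> / 2) (b - a) / 2\<close>, and \<open>b - a\<close> almost vanishes on
  unmarked arcs. Since the walk preserves the Euclidean norm, it suffices to bound the weight left
  on unmarked arcs at the time when \<open>t \<theta>\<close> is nearly \<open>\<pi> / 2\<close>.
\<close>

section \<open>Elementary inequalities\<close>

lemma one_minus_cos_le: "1 - cos x \<le> x\<^sup>2 / 2" for x :: real
proof -
  have "(sin (x / 2))\<^sup>2 \<le> (x / 2)\<^sup>2"
    using abs_sin_x_le_abs_x[of "x / 2"] abs_le_square_iff by blast
  then show ?thesis using cos_double_sin[of "x / 2"] by (simp add: power_divide)
qed

text \<open>The mean value theorem gives \<open>sin (x / 2) = x / 2 * cos z\<close> with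
  \<open>cos z \<ge> 1 / 2\<close>, and \<open>1 - cos x\<close> is twice the square of
  \<open>sin (x / 2)\<close>. The range up to \<open>pi / 3\<close> is that of arccos on
  \<open>[1 / 2, 1]\<close>, where the top eigenvalue will lie.\<close>

lemma one_minus_cos_ge:
  assumes "0 \<le> x" "x \<le> pi / 3"
  shows "x\<^sup>2 / 8 \<le> 1 - cos x"
proof -
  have "x / 4 \<le> sin (x / 2)"
  proof (cases "x = 0")
    case False
    then have "0 < x / 2" using assms by simp
    then obtain z where z: "0 < z" "z < x / 2" "sin (x / 2) - sin 0 = (x / 2 - 0) * cos z"
      using MVT2[of 0 "x / 2" sin cos] by (metis DERIV_sin)
    have "cos (pi / 3) \<le> cos z"
      using z assms by (intro cos_monotone_0_pi_le) auto
    then have "1 / 2 \<le> cos z" by (simp add: cos_60)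
    then have "x / 2 * (1 / 2) \<le> x / 2 * cos z" using assms by (intro mult_left_mono) auto
    then show ?thesis using z(3) by simp
  qed simp
  then have "(x / 4)\<^sup>2 \<le> (sin (x / 2))\<^sup>2" using assms by (intro power_mono) auto
  then show ?thesis using cos_double_sin[of "x / 2"] by (simp add: power_divide)
qed

text \<open>Rounding down costs at most a factor 2 once the argument reaches 1; this yields the
  lower bound on the searching time.\<close>

lemma half_le_floor: "x / 2 \<le> of_int \<lfloor>x\<rfloor>" if "1 \<le> x" for x :: real
proof -
  have "1 \<le> \<lfloor>x\<rfloor>" using that by simp
  then have "1 \<le> real_of_int \<lfloor>x\<rfloor>" by simp
  then show ?thesis using floor_correct[of x] by linarith
qed

lemma half_sum_square_le: "((x + y) / 2)\<^sup>2 \<le> (x\<^sup>2 + y\<^sup>2) / 2" for x y :: real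
  using zero_le_power2[of "x - y"] by (simp add: power_divide power2_eq_square algebra_simps)

lemma half_diff_square_le: "((x - y) / 2)\<^sup>2 \<le> (x\<^sup>2 + y\<^sup>2) / 2" for x y :: real
  using half_sum_square_le[of x "- y"] by simp

lemma square_sum3_le: "(x + y + z)\<^sup>2 \<le> 3 * (x\<^sup>2 + y\<^sup>2 + z\<^sup>2)" for x y z :: real
  using zero_le_power2[of "x - y"] zero_le_power2[of "y - z"] zero_le_power2[of "x - z"]
  by (simp add: power2_eq_square algebra_simps)

section \<open>The largest eigenvalue of a symmetric matrix\<close>

text \<open>Variational principle: a maximiser of the quadratic form on the unit sphere exists by
  compactness, and the vanishing of the first variation there is the eigenvalue equation.\<close>

lemma symmetric_quadratic_form_max:
  fixes a :: "nat \<Rightarrow> nat \<Rightarrow> real"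
  assumes sym: "\<And>i j. i < n \<Longrightarrow> j < n \<Longrightarrow> a i j = a j i" and "n > 0"
  obtains w \<mu> where "\<exists>i<n. w i \<noteq> 0"
    and "\<And>i. i < n \<Longrightarrow> (\<Sum>j<n. a i j * w j) = \<mu> * w i"
    and "\<And>x. (\<Sum>i<n. \<Sum>j<n. a i j * x i * x j) \<le> \<mu> * (\<Sum>i<n. (x i)\<^sup>2)"
proof -
  define Q where "Q x = (\<Sum>i<n. \<Sum>j<n. a i j * x i * x j)" for x :: "nat \<Rightarrow> real"
  define N where "N x = (\<Sum>i<n. (x i)\<^sup>2)" for x :: "nat \<Rightarrow> real"
  \<comment> \<open>Vectors of length \<open>n\<close> are functions on the naturals that vanish
    from \<open>n\<close> on. The cube \<open>B\<close> is compact by Tychonoff, and the unit sphere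
    is its closed subset \<open>N x = 1\<close>.\<close>
  define B where "B = PiE UNIV (\<lambda>i. if i < n then {-1..1::real} else {0})"
  have cont_Q: "continuous_on S Q" and cont_N: "continuous_on S N" for S
    unfolding Q_def N_def
    by (intro continuous_intros continuous_on_subset[OF continuous_on_product_coordinates] subset_UNIV)+
  have "compactin (product_topology (\<lambda>_. euclidean) UNIV) B"
    unfolding B_def by (subst compactin_PiE) auto
  then have "compact B" by (simp add: euclidean_product_topology)
  moreover have "closed {x. N x = 1}"
    using continuous_closed_preimage_constant[OF cont_N closed_UNIV, of 1] by (simp add: vimage_def)
  ultimately have "compact (B \<inter> {x. N x = 1})" by (rule compact_Int_closed)
  moreover have "(\<lambda>i. if i = 0 then 1 else 0) \<in> B \<inter> {x. N x = 1}"
    using \<open>n > 0\<close> by (auto simp: B_def N_def if_distrib[of "\<lambda>t. t\<^sup>2"] cong: if_cong)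
  ultimately obtain w where w: "w \<in> B" "N w = 1"
    and w_max: "\<And>x. x \<in> B \<Longrightarrow> N x = 1 \<Longrightarrow> Q x \<le> Q w"
    using continuous_attains_sup[of "B \<inter> {x. N x = 1}" Q] cont_Q by blast
  have le: "Q x \<le> Q w * N x" for x
  proof (cases "N x = 0")
    case True
    then have "x i = 0" if "i < n" for i
      using that unfolding N_def by (subst (asm) sum_nonneg_eq_0_iff) auto
    then have "Q x = 0" by (simp add: Q_def)
    with True show ?thesis by simp
  next
    case False
    have "N x \<ge> 0" by (simp add: N_def sum_nonneg)
    with False have pos: "N x > 0" by simp
    define y where "y i = (if i < n then x i / sqrt (N x) else 0)" for i
    have y2: "(y i)\<^sup>2 = (x i)\<^sup>2 / N x" if "i < n" for i
      using that pos by (simp add: y_def power_divide)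
    have Ny: "N y = 1"
      using y2 pos False by (simp add: N_def sum_divide_distrib[symmetric])
    have "(y i)\<^sup>2 \<le> 1\<^sup>2" if "i < n" for i
      using member_le_sum[of i "{..<n}" "\<lambda>i. (y i)\<^sup>2"] that Ny by (simp add: N_def)
    then have "- 1 \<le> y i \<and> y i \<le> 1" if "i < n" for i
      using that abs_le_iff[of "y i" 1] by (simp add: abs_le_square_iff[symmetric] del: one_power2 power_one)
    then have "y \<in> B"
      unfolding B_def by (simp add: PiE_def Pi_def) (simp add: y_def)
    have "Q y = (\<Sum>i<n. \<Sum>j<n. a i j * x i * x j / N x)"
      using pos unfolding Q_def by (intro sum.cong refl) (auto simp: y_def)
    also have "\<dots> = Q x / N x" by (simp add: Q_def sum_divide_distrib)
    finally show ?thesis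
      using w_max[OF \<open>y \<in> B\<close> Ny] pos by (simp add: pos_divide_le_eq)
  qed
  have eq: "(\<Sum>j<n. a i j * w j) = Q w * w i" if "i < n" for i
  proof -
    \<comment> \<open>The residual of the eigenvalue equation serves as the direction of variation.
      The difference \<open>Q x - Q w * N x\<close> is never positive and vanishes at
      \<open>w\<close>; along \<open>w + e * h\<close> its part linear in \<open>e\<close> is
      \<open>2 * e * N h\<close>, which is thus bounded by a term quadratic in
      \<open>e\<close>.\<close>
    define h where "h i = (\<Sum>j<n. a i j * w j) - Q w * w i" for i
    have "N (\<lambda>i. w i + e * h i) = N w + 2 * e * (\<Sum>i<n. h i * w i) + e\<^sup>2 * N h" for e
      unfolding N_def
      by (simp add: power2_sum power_mult_distrib sum.distrib sum_distrib_left algebra_simps)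
    moreover have "Q (\<lambda>i. w i + e * h i) =
        Q w + 2 * e * (\<Sum>i<n. h i * (\<Sum>j<n. a i j * w j)) + e\<^sup>2 * Q h" for e
    proof -
      have "(\<Sum>i<n. \<Sum>j<n. a i j * w i * h j) = (\<Sum>i<n. \<Sum>j<n. h i * (a i j * w j))"
        by (subst sum.swap) (auto intro!: sum.cong simp: sym)
      moreover have "Q (\<lambda>i. w i + e * h i) = Q w + e * (\<Sum>i<n. \<Sum>j<n. a i j * w i * h j)
          + e * (\<Sum>i<n. \<Sum>j<n. h i * (a i j * w j)) + e\<^sup>2 * Q h"
        unfolding Q_def
        by (simp add: algebra_simps sum.distrib sum_distrib_left power2_eq_square)
      ultimately show ?thesis by (simp add: sum_distrib_left mult.assoc)
    qed
    ultimately have "Q w + 2 * e * (\<Sum>i<n. h i * (\<Sum>j<n. a i j * w j)) + e\<^sup>2 * Q h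
        \<le> Q w * (N w + 2 * e * (\<Sum>i<n. h i * w i) + e\<^sup>2 * N h)" for e
      by (metis le)
    moreover have "(\<Sum>i<n. h i * (\<Sum>j<n. a i j * w j)) - Q w * (\<Sum>i<n. h i * w i) = N h"
    proof -
      have "h i * (\<Sum>j<n. a i j * w j) - Q w * (h i * w i) = (h i)\<^sup>2" for i
        by (simp add: h_def power2_eq_square algebra_simps)
      then show ?thesis
        by (simp only: N_def sum_distrib_left[where r = "Q w"] sum_subtractf[symmetric])
    qed
    ultimately have *: "2 * e * N h \<le> e\<^sup>2 * (Q w * N h - Q h)" for e
      using w(2) by (simp add: algebra_simps)
    have "N h \<le> 0"
    proof (rule ccontr)
      define K where "K = \<bar>Q w * N h - Q h\<bar> + 1"
      assume "\<not> N h \<le> 0"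
      then have pos: "N h > 0" by simp
      have K: "K > 0" "Q w * N h - Q h \<le> K" by (auto simp: K_def)
      \<comment> \<open>The choice \<open>e = N h / K\<close> makes the linear term twice the bound
        on the quadratic one, which is impossible for \<open>N h > 0\<close>.\<close>
      have "2 * (N h / K) * N h \<le> (N h / K)\<^sup>2 * K"
        using *[of "N h / K"] mult_left_mono[OF K(2), of "(N h / K)\<^sup>2"] by simp
      then show False using pos K(1) by (simp add: field_simps power2_eq_square)
    qed
    then have "N h = 0" unfolding N_def by (intro antisym sum_nonneg) auto
    then have "h i = 0"
      using that unfolding N_def by (subst (asm) sum_nonneg_eq_0_iff) auto
    then show ?thesis by (simp add: h_def)
  qed
  have "\<exists>i<n. w i \<noteq> 0"
    using w(2) unfolding N_def by (metis (no_types, lifting) lessThan_iff power_zero_numeral sum.neutral zero_neq_one)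
  then show ?thesis
    using that[of w "Q w"] eq le by (simp add: Q_def N_def)
qed

text \<open>Matrix form of the variational principle. It provides a real eigenvalue at all, and it
  lets any test vector bound the largest one from below.\<close>

lemma symmetric_mat_eigenvalue_ge:
  fixes A :: "real mat"
  assumes A: "A \<in> carrier_mat n n" and sym: "transpose_mat A = A" and "n > 0"
  obtains \<mu> where "eigenvalue A \<mu>"
    and "\<And>x. x \<in> carrier_vec n \<Longrightarrow> x \<bullet> (A *\<^sub>v x) \<le> \<mu> * (x \<bullet> x)"
proof -
  have "A $$ (i, j) = A $$ (j, i)" if "i < n" "j < n" for i j
    using that A sym by (metis carrier_matD index_transpose_mat(1))
  then obtain w \<mu> where w: "\<exists>i<n. w i \<noteq> 0"
      "\<And>i. i < n \<Longrightarrow> (\<Sum>j<n. A $$ (i, j) * w j) = \<mu> * w i"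
      "\<And>x. (\<Sum>i<n. \<Sum>j<n. A $$ (i, j) * x i * x j) \<le> \<mu> * (\<Sum>i<n. (x i)\<^sup>2)"
    using symmetric_quadratic_form_max[of n "\<lambda>i j. A $$ (i, j)"] \<open>n > 0\<close> by blast
  have "eigenvector A (vec n w) \<mu>"
    unfolding eigenvector_def using A w(1,2)
    by (auto simp: scalar_prod_def atLeast0LessThan vec_eq_iff intro!: eq_vecI)
  moreover have "x \<bullet> (A *\<^sub>v x) \<le> \<mu> * (x \<bullet> x)" if "x \<in> carrier_vec n" for x
    using w(3)[of "\<lambda>i. x $ i"] that A
    by (simp add: scalar_prod_def atLeast0LessThan power2_eq_square sum_distrib_left mult_ac)
  ultimately show ?thesis using that unfolding eigenvalue_def by blast
qed

section \<open>Signed complete graphs and the discriminant\<close>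

lemma arcs_iff: "(u, v) \<in> arcs n \<longleftrightarrow> u \<le> n \<and> v \<le> n \<and> u \<noteq> v"
  unfolding arcs_def edges_def verts_def by (auto simp: doubleton_eq_iff)

lemma finite_arcs: "finite (arcs n)"
  unfolding set_arc_list[symmetric] by simp

lemma sum_arcs: "(\<Sum>e\<in>arcs n. f e) = (\<Sum>u\<le>n. \<Sum>v\<in>{..n} - {u}. f (u, v))"
proof -
  have "arcs n = (SIGMA u:{..n}. {..n} - {u})" by (auto simp: arcs_iff)
  then show ?thesis by (simp add: sum.Sigma)
qed

lemma sum_arcs_swap: "(\<Sum>(u, v)\<in>arcs n. f u v) = (\<Sum>(u, v)\<in>arcs n. f v u)"
  by (rule sum.reindex_bij_witness[of _ prod.swap prod.swap]) (auto simp: arcs_iff)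

text \<open>Each two-element set has exactly two orientations. Applied both to all edges and to the
  marked ones.\<close>

lemma card_symmetric_pairs:
  assumes "finite F" and "\<And>e. e \<in> F \<Longrightarrow> card e = 2"
  shows "card {(u, v). {u, v} \<in> F} = 2 * card F"
  using assms
proof (induction F rule: finite_induct)
  case (insert e F)
  obtain a b where e: "e = {a, b}" "a \<noteq> b"
    using insert.prems[of e] by (auto simp: card_2_iff)
  have split: "{(u, v). {u, v} \<in> insert e F} = {(a, b), (b, a)} \<union> {(u, v). {u, v} \<in> F}"
    by (auto simp: e doubleton_eq_iff)
  have "{(u, v). {u, v} \<in> F} \<subseteq> \<Union>F \<times> \<Union>F" by auto
  moreover have "finite (\<Union>F)"
    using insert.hyps(1) insert.prems
    by (metis card.infinite finite_Union insertCI zero_neq_numeral)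
  ultimately have "finite {(u, v). {u, v} \<in> F}" by (simp add: finite_subset)
  moreover have "{(a, b), (b, a)} \<inter> {(u, v). {u, v} \<in> F} = {}"
    using insert.hyps e by (auto simp: insert_commute)
  ultimately have "card {(u, v). {u, v} \<in> insert e F} = 2 + card {(u, v). {u, v} \<in> F}"
    unfolding split using e(2) by (subst card_Un_disjoint) auto
  with insert show ?case by simp
qed simp

lemma card_edge: "e \<in> edges n \<Longrightarrow> card e = 2"
  by (auto simp: edges_def)

lemma finite_edges: "finite (edges n)"
  by (rule finite_subset[of _ "Pow {..n}"]) (auto simp: edges_def verts_def)

lemma card_arcs: "card (arcs n) = n * (n + 1)"
proof -
  have "real (card (arcs n)) = (\<Sum>e\<in>arcs n. 1)" by simp
  also have "\<dots> = real (n * (n + 1))" unfolding sum_arcs by (simp add: algebra_simps)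
  finally show ?thesis by linarith
qed

lemma num_arcs_eq: "num_arcs n = n * (n + 1)"
  using distinct_card[OF distinct_arc_list] by (simp add: num_arcs_def set_arc_list card_arcs)

lemma card_edges: "2 * card (edges n) = n * (n + 1)"
  using card_symmetric_pairs[OF finite_edges[of n] card_edge[of _ n]] card_arcs[of n]
  by (simp add: arcs_def)

section \<open>Signs and degrees in the marked graph\<close>

locale signed_complete_graph =
  fixes n :: nat and \<sigma> :: "nat \<times> nat \<Rightarrow> real"
  assumes n_ge_2: "n \<ge> 2" and admissible: "admissible n \<sigma>"
begin

definition adj :: "nat \<Rightarrow> nat \<Rightarrow> real" where
  "adj u v = of_bool ({u, v} \<in> marked_edges n \<sigma>)"

definition deg :: "nat \<Rightarrow> real" where
  "deg u = (\<Sum>v\<le>n. adj u v)"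

abbreviation "m \<equiv> real (card (marked_edges n \<sigma>))"
abbreviation "k \<equiv> real (card (marked_verts n \<sigma>))"

lemma marked_edges_subset: "marked_edges n \<sigma> \<subseteq> edges n"
  by (auto simp: marked_edges_def)

lemma finite_marked_edges: "finite (marked_edges n \<sigma>)"
  using marked_edges_subset finite_edges finite_subset by blast

lemma finite_marked_verts: "finite (marked_verts n \<sigma>)"
  unfolding marked_verts_def using finite_marked_edges marked_edges_subset card_edge
  by (metis card.infinite finite_Union subsetD zero_neq_numeral)

lemma marked_edge_iff:
  "{u, v} \<in> marked_edges n \<sigma> \<longleftrightarrow> (u, v) \<in> arcs n \<and> edge_sign \<sigma> u v = -1"
  unfolding marked_edges_def arcs_def edge_sign_def
  by (auto simp: doubleton_eq_iff mult.commute insert_commute)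

lemma marked_arcs_iff: "(u, v) \<in> marked_arcs n \<sigma> \<longleftrightarrow> {u, v} \<in> marked_edges n \<sigma>"
  by (simp add: marked_arcs_def)

lemma marked_arcs_subset: "marked_arcs n \<sigma> \<subseteq> arcs n"
  by (auto simp: marked_arcs_iff marked_edge_iff)

lemma adj_commute: "adj u v = adj v u"
  by (simp add: adj_def insert_commute)

lemma adj_refl: "adj u u = 0"
  using marked_edge_iff[of u u] by (simp add: adj_def arcs_iff)

lemma adj_nonneg: "adj u v \<ge> 0"
  by (simp add: adj_def)

lemma deg_nonneg: "deg u \<ge> 0"
  by (simp add: deg_def adj_nonneg sum_nonneg)

lemma sign_cases: "(u, v) \<in> arcs n \<Longrightarrow> \<sigma> (u, v) = 1 \<or> \<sigma> (u, v) = -1"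
  using admissible by (auto simp: admissible_def)

lemma sign_square: "(u, v) \<in> arcs n \<Longrightarrow> \<sigma> (u, v) * \<sigma> (u, v) = 1"
  using sign_cases by fastforce

lemma sign_inv: "(u, v) \<in> arcs n \<Longrightarrow> \<sigma> (u, v) = -1 \<Longrightarrow> \<sigma> (v, u) = 1"
  using admissible by (fastforce simp: admissible_def arc_inv_def arc_target_def arc_origin_def)

lemma edge_sign_eq: "(u, v) \<in> arcs n \<Longrightarrow> edge_sign \<sigma> u v = 1 - 2 * adj u v"
  using sign_cases[of u v] sign_cases[of v u] marked_edge_iff[of u v]
  by (auto simp: adj_def edge_sign_def arcs_iff)

text \<open>The product of the two signs is not -1, so they agree, and admissibility excludes that
  both are -1.\<close>

lemma unmarked_sign:
  assumes "(u, v) \<in> arcs n" "(u, v) \<notin> marked_arcs n \<sigma>"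
  shows "\<sigma> (u, v) = 1" "\<sigma> (v, u) = 1"
proof -
  have "\<sigma> (u, v) * \<sigma> (v, u) \<noteq> -1"
    using assms by (simp add: marked_arcs_iff marked_edge_iff edge_sign_def)
  moreover have "(v, u) \<in> arcs n" using assms(1) by (simp add: arcs_iff)
  ultimately show "\<sigma> (u, v) = 1" "\<sigma> (v, u) = 1"
    using sign_cases[OF assms(1)] sign_cases[of v u] sign_inv[OF assms(1)] by auto
qed

lemma card_marked_arcs: "real (card (marked_arcs n \<sigma>)) = 2 * m"
  using card_symmetric_pairs[OF finite_marked_edges] card_edge marked_edges_subset
  by (fastforce simp: marked_arcs_def)

lemma m_ge_1: "m \<ge> 1"
  using admissible finite_marked_edges
  by (simp add: admissible_def Suc_le_eq card_gt_0_iff)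

lemma sum_deg: "(\<Sum>u\<le>n. deg u) = 2 * m"
proof -
  have "(\<Sum>u\<le>n. deg u) = (\<Sum>u\<le>n. \<Sum>v\<in>{..n} - {u}. adj u v)"
    unfolding deg_def by (intro sum.cong refl sum.mono_neutral_right) (auto simp: adj_refl)
  also have "\<dots> = (\<Sum>e\<in>arcs n. of_bool (e \<in> marked_arcs n \<sigma>))"
    by (simp add: sum_arcs marked_arcs_iff adj_def)
  also have "\<dots> = real (card (marked_arcs n \<sigma>))"
    using marked_arcs_subset finite_arcs by (simp add: Int_absorb1 Int_commute)
  finally show ?thesis by (simp add: card_marked_arcs)
qed

lemma deg_le: "deg u \<le> k"
proof -
  have "deg u = real (card ({..n} \<inter> {v. {u, v} \<in> marked_edges n \<sigma>}))"
    by (simp add: deg_def adj_def)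
  also have "\<dots> \<le> k"
    using finite_marked_verts by (auto intro!: card_mono simp: marked_verts_def)
  finally show ?thesis .
qed

text \<open>With \<open>J\<close> the all-ones matrix, \<open>I\<close> the identity and
  \<open>A\<close> the adjacency matrix of the marked graph, \<open>n\<close> times the discriminant
  is \<open>J - I - 2 * A\<close>, a perturbation of the complete graph by the marked
  degrees.\<close>

lemma sum_edge_sign:
  assumes "u \<le> n"
  shows "(\<Sum>v\<in>{..n} - {u}. edge_sign \<sigma> u v * f v) =
    (\<Sum>v\<le>n. f v) - f u - 2 * (\<Sum>v\<le>n. adj u v * f v)"
proof -
  have "(\<Sum>v\<in>{..n} - {u}. edge_sign \<sigma> u v * f v) = (\<Sum>v\<in>{..n} - {u}. f v - 2 * (adj u v * f v))"
    using assms by (intro sum.cong refl) (auto simp: edge_sign_eq arcs_iff algebra_simps)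
  also have "\<dots> = (\<Sum>v\<in>{..n} - {u}. f v) - 2 * (\<Sum>v\<in>{..n} - {u}. adj u v * f v)"
    by (simp add: sum_subtractf sum_distrib_left)
  finally show ?thesis
    using assms by (simp add: sum_diff1 adj_refl)
qed

section \<open>The top eigenvalue and its eigenfunction\<close>

lemma discriminant_eigenvalue_function:
  fixes \<mu> :: real
  assumes "eigenvalue (discriminant_mat n \<sigma>) \<mu>"
  obtains w :: "nat \<Rightarrow> real" where "\<exists>u\<le>n. w u \<noteq> 0"
    and "\<And>u. u \<le> n \<Longrightarrow> (\<Sum>v\<in>{..n} - {u}. edge_sign \<sigma> u v * w v) = n * \<mu> * w u"
proof -
  have dim: "dim_row (discriminant_mat n \<sigma>) = Suc n" "dim_col (discriminant_mat n \<sigma>) = Suc n"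
    by (auto simp: discriminant_mat_def boundary_mat_def)
  obtain x where x: "x \<in> carrier_vec (Suc n)" "x \<noteq> 0\<^sub>v (Suc n)"
      "discriminant_mat n \<sigma> *\<^sub>v x = \<mu> \<cdot>\<^sub>v x"
    using assms by (auto simp: eigenvalue_def eigenvector_def dim)
  have "(\<Sum>v\<in>{..n} - {u}. edge_sign \<sigma> u v * x $ v) = n * \<mu> * x $ u" if "u \<le> n" for u
  proof -
    have "\<mu> * x $ u = (discriminant_mat n \<sigma> *\<^sub>v x) $ u" using x(1,3) that by simp
    also have "\<dots> = (\<Sum>v\<le>n. discriminant_mat n \<sigma> $$ (u, v) * x $ v)"
      using that x(1) dim by (simp add: scalar_prod_def lessThan_Suc_atMost atLeast0LessThan)
    also have "\<dots> = (\<Sum>v\<le>n. if v = u then 0 else edge_sign \<sigma> u v * x $ v / n)"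
      using that by (intro sum.cong refl) (auto simp: discriminant_mat_entry)
    also have "\<dots> = (\<Sum>v\<in>{..n} - {u}. edge_sign \<sigma> u v * x $ v / n)"
      using that by (intro sum.mono_neutral_cong_right) auto
    also have "\<dots> = (\<Sum>v\<in>{..n} - {u}. edge_sign \<sigma> u v * x $ v) / n"
      by (simp add: sum_divide_distrib)
    finally show ?thesis using n_ge_2 by (simp add: field_simps)
  qed
  moreover have "\<exists>u\<le>n. x $ u \<noteq> 0"
    using x(1,2) by (metis carrier_vecD eq_vecI index_zero_vec less_Suc_eq_le)
  ultimately show ?thesis using that[of "\<lambda>u. x $ u"] by blast
qed

text \<open>An eigenvalue of at least \<open>1 / 2\<close> dominates the marked degrees, which are
  at most \<open>k \<le> n / 16\<close>. The eigenvalue equation then forces its eigenfunction to be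
  nearly constant, and summing the equation determines the gap \<open>1 - \<mu>\<close> up to a
  constant factor.\<close>

lemma discriminant_top_eigenfunction:
  fixes \<mu> :: real
  assumes ev: "eigenvalue (discriminant_mat n \<sigma>) \<mu>" and \<mu>: "\<mu> \<ge> 1 / 2" and k: "16 * k \<le> n"
  obtains f :: "nat \<Rightarrow> real" where
      "\<And>u. u \<le> n \<Longrightarrow> (\<Sum>v\<in>{..n} - {u}. edge_sign \<sigma> u v * f v) = n * \<mu> * f u"
    and "\<And>u. u \<le> n \<Longrightarrow> \<bar>1 - f u\<bar> \<le> 8 * deg u / n"
    and "\<And>u. u \<le> n \<Longrightarrow> 1 / 2 \<le> f u \<and> f u \<le> 3 / 2"
    and "m / n\<^sup>2 \<le> 1 - \<mu>" and "1 - \<mu> \<le> 12 * m / n\<^sup>2"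
proof -
  obtain w :: "nat \<Rightarrow> real" where w_nz: "\<exists>u\<le>n. w u \<noteq> 0"
    and w: "\<And>u. u \<le> n \<Longrightarrow> (\<Sum>v\<in>{..n} - {u}. edge_sign \<sigma> u v * w v) = n * \<mu> * w u"
    using discriminant_eigenvalue_function[OF ev] by metis
  \<comment> \<open>Adding \<open>w u\<close> to both sides of the eigenvalue equation completes the
    sum over all vertices, so the row reads
    \<open>L * w u = s - 2 * (\<Sum>v\<le>n. adj u v * w v)\<close>.\<close>
  define L :: real where "L = n * \<mu> + 1"
  define s :: real where "s = (\<Sum>v\<le>n. w v)"
  define M :: real where "M = Max ((\<lambda>v. \<bar>w v\<bar>) ` {..n})"
  have L: "L \<ge> n / 2" using mult_left_mono[OF \<mu>, of n] by (simp add: L_def)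
  have Lpos: "L > 0" using L n_ge_2 by simp
  have M_ge: "\<bar>w v\<bar> \<le> M" if "v \<le> n" for v using that by (auto simp: M_def intro!: Max_ge)
  have Mpos: "M > 0" using w_nz M_ge by fastforce
  have eq: "L * w u = s - 2 * (\<Sum>v\<le>n. adj u v * w v)" if "u \<le> n" for u
    using w[OF that] sum_edge_sign[OF that, of w] by (simp add: L_def s_def algebra_simps)
  have adj_w: "\<bar>\<Sum>v\<le>n. adj u v * w v\<bar> \<le> deg u * M" for u
  proof -
    have "\<bar>\<Sum>v\<le>n. adj u v * w v\<bar> \<le> (\<Sum>v\<le>n. \<bar>adj u v * w v\<bar>)" by (rule sum_abs)
    also have "\<dots> \<le> (\<Sum>v\<le>n. adj u v * M)"
      using M_ge adj_nonneg by (auto intro!: sum_mono mult_left_mono simp: abs_mult)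
    finally show ?thesis by (simp add: deg_def sum_distrib_right)
  qed
  have "M \<in> (\<lambda>v. \<bar>w v\<bar>) ` {..n}" unfolding M_def by (rule Max_in) auto
  then obtain u0 where u0: "u0 \<le> n" "M = \<bar>w u0\<bar>" by auto
  \<comment> \<open>At a vertex where \<open>\<bar>w u\<bar>\<close> is maximal,
    \<open>k \<le> n / 16 \<le> L / 8\<close> lets the left side absorb the adjacency term. Hence
    the total \<open>s\<close> is nonzero and can be used for normalisation.\<close>
  have "L * M = \<bar>L * w u0\<bar>" using u0 Lpos by (simp add: abs_mult)
  also have "\<dots> \<le> \<bar>s\<bar> + 2 * (deg u0 * M)" using eq[OF u0(1)] adj_w[of u0] by linarith
  also have "deg u0 * M \<le> k * M" using deg_le Mpos by simp
  also have "k * M \<le> L / 8 * M" using k L Mpos by (intro mult_right_mono) auto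
  finally have "L * M \<le> \<bar>s\<bar> + L * M / 4" by simp
  then have LM: "L * M \<le> 2 * \<bar>s\<bar>" using abs_ge_zero[of s] by linarith
  moreover have "L * M > 0" using Lpos Mpos by simp
  ultimately have s: "s \<noteq> 0" by auto
  \<comment> \<open>With this scaling \<open>f\<close> takes the value 1 outside the marked vertices.\<close>
  define f where "f u = L / s * w u" for u
  have f_w: "L * (1 - f u) = L / s * (2 * (\<Sum>v\<le>n. adj u v * w v))" if "u \<le> n" for u
  proof -
    have "L * (1 - f u) = L / s * (s - L * w u)" using s by (simp add: f_def field_simps)
    then show ?thesis by (simp add: eq[OF that])
  qed
  have f_eq: "L * (1 - f u) = 2 * (\<Sum>v\<le>n. adj u v * f v)" if "u \<le> n" for u
    unfolding f_w[OF that] by (simp add: f_def sum_distrib_left mult_ac)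
  \<comment> \<open>The bound \<open>L * M \<le> 2 * \<bar>s\<bar>\<close> gives
    \<open>L * \<bar>1 - f u\<bar> \<le> 4 * deg u\<close>, and \<open>L \<ge> n / 2\<close> turns 4
    into 8.\<close>
  have near: "\<bar>1 - f u\<bar> \<le> 8 * deg u / n" if "u \<le> n" for u
  proof -
    have "L * \<bar>1 - f u\<bar> = \<bar>L * (1 - f u)\<bar>" using Lpos by (simp add: abs_mult)
    also have "\<dots> = \<bar>L / s * (2 * (\<Sum>v\<le>n. adj u v * w v))\<bar>"
      by (simp add: f_w[OF that])
    also have "\<dots> = 2 * (L / \<bar>s\<bar>) * \<bar>\<Sum>v\<le>n. adj u v * w v\<bar>"
      using Lpos by (simp add: abs_mult)
    also have "\<dots> \<le> 2 * (L / \<bar>s\<bar>) * (deg u * M)"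
      using adj_w Lpos by (intro mult_left_mono) auto
    also have "\<dots> = 2 * deg u * (L * M / \<bar>s\<bar>)" by simp
    also have "\<dots> \<le> 2 * deg u * 2"
      using LM s deg_nonneg[of u] by (intro mult_left_mono) (auto simp: field_simps)
    finally have "L * \<bar>1 - f u\<bar> \<le> 4 * deg u" by simp
    moreover have "n / 2 * \<bar>1 - f u\<bar> \<le> L * \<bar>1 - f u\<bar>" using L by (intro mult_right_mono) auto
    ultimately show ?thesis using n_ge_2 by (simp add: field_simps)
  qed
  have range: "1 / 2 \<le> f u \<and> f u \<le> 3 / 2" if "u \<le> n" for u
  proof -
    have "8 * deg u / n \<le> 1 / 2" using deg_le[of u] k n_ge_2 by (simp add: field_simps)
    with near[OF that] show ?thesis by (simp add: abs_le_iff)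
  qed
  have f_ev: "(\<Sum>v\<in>{..n} - {u}. edge_sign \<sigma> u v * f v) = n * \<mu> * f u" if "u \<le> n" for u
  proof -
    have "(\<Sum>v\<in>{..n} - {u}. edge_sign \<sigma> u v * f v) =
        L / s * (\<Sum>v\<in>{..n} - {u}. edge_sign \<sigma> u v * w v)"
      by (simp add: f_def sum_distrib_left mult_ac)
    then show ?thesis by (simp add: w[OF that] f_def)
  qed
  \<comment> \<open>Since \<open>f\<close> sums to \<open>L = n * \<mu> + 1\<close>, the deficits
    \<open>1 - f u\<close> sum to \<open>n * (1 - \<mu>)\<close>. Summing the row equations
    expresses \<open>L\<close> times this as \<open>2 * (\<Sum>v\<le>n. deg v * f v)\<close>, which
    lies between \<open>2 * m\<close> and \<open>6 * m\<close>; finally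
    \<open>n / 2 \<le> L \<le> 2 * n\<close>.\<close>
  have "(\<Sum>u\<le>n. f u) = L / s * s"
    unfolding f_def sum_distrib_left[symmetric] s_def[symmetric] ..
  then have "(\<Sum>u\<le>n. f u) = L" using s by simp
  then have "(\<Sum>u\<le>n. 1 - f u) = n * (1 - \<mu>)" by (simp add: sum_subtractf L_def algebra_simps)
  moreover have "(\<Sum>u\<le>n. L * (1 - f u)) = 2 * (\<Sum>v\<le>n. deg v * f v)"
  proof -
    have "(\<Sum>u\<le>n. L * (1 - f u)) = (\<Sum>u\<le>n. 2 * (\<Sum>v\<le>n. adj u v * f v))"
      by (intro sum.cong refl) (simp add: f_eq)
    also have "\<dots> = 2 * (\<Sum>v\<le>n. \<Sum>u\<le>n. adj u v * f v)"
      unfolding sum_distrib_left[symmetric] by (subst sum.swap) simp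
    also have "\<dots> = 2 * (\<Sum>v\<le>n. deg v * f v)"
      by (simp add: deg_def sum_distrib_right adj_commute)
    finally show ?thesis .
  qed
  ultimately have gap: "L * (n * (1 - \<mu>)) = 2 * (\<Sum>v\<le>n. deg v * f v)"
    by (simp add: sum_distrib_left[symmetric])
  have "(\<Sum>v\<le>n. deg v * f v) \<ge> (\<Sum>v\<le>n. deg v * (1 / 2))"
    using range deg_nonneg by (intro sum_mono mult_left_mono) auto
  also have "(\<Sum>v\<le>n. deg v * (1 / 2)) = m"
    unfolding sum_distrib_right[symmetric] by (simp add: sum_deg)
  finally have lower: "(\<Sum>v\<le>n. deg v * f v) \<ge> m" .
  have "(\<Sum>v\<le>n. deg v * f v) \<le> (\<Sum>v\<le>n. deg v * (3 / 2))"
    using range deg_nonneg by (intro sum_mono mult_left_mono) auto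
  also have "(\<Sum>v\<le>n. deg v * (3 / 2)) = 3 * m"
    unfolding sum_distrib_right[symmetric] by (simp add: sum_deg)
  finally have upper: "(\<Sum>v\<le>n. deg v * f v) \<le> 3 * m" .
  have npos: "real n > 0" using n_ge_2 by simp
  have "L * (n * (1 - \<mu>)) > 0" using gap lower m_ge_1 by simp
  then have \<mu>1: "n * (1 - \<mu>) > 0" "\<mu> < 1" using Lpos npos by (auto simp: zero_less_mult_iff)
  have "n * \<mu> \<le> real n * 1" using \<mu>1 by (intro mult_left_mono) auto
  then have "L \<le> 2 * n" using n_ge_2 unfolding L_def by linarith
  then have "L * (n * (1 - \<mu>)) \<le> 2 * n * (n * (1 - \<mu>))" using \<mu>1 by (intro mult_right_mono) auto
  with gap lower have "2 * m \<le> 2 * n * (n * (1 - \<mu>))" by linarith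
  then have g1: "m / n\<^sup>2 \<le> 1 - \<mu>" using npos by (simp add: field_simps power2_eq_square)
  have "n / 2 * (n * (1 - \<mu>)) \<le> L * (n * (1 - \<mu>))" using L \<mu>1 by (intro mult_right_mono) auto
  with gap upper have "n / 2 * (n * (1 - \<mu>)) \<le> 6 * m" by linarith
  then have g2: "1 - \<mu> \<le> 12 * m / n\<^sup>2" using npos by (simp add: field_simps power2_eq_square)
  show ?thesis using that[OF f_ev near range g1 g2] .
qed

text \<open>The eigenvalues are the finitely many roots of the characteristic polynomial, and the
  variational principle supplies one of them, so the maximum is attained. The lower bound is the
  Rayleigh quotient of the all-ones vector.\<close>

lemma lambda_max_eigenvalue:
  "eigenvalue (discriminant_mat n \<sigma>) (lambda_max n \<sigma>)" (is ?ev)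
  and lambda_max_ge: "lambda_max n \<sigma> \<ge> 1 - 4 * m / (n * (n + 1))" (is ?ge)
proof -
  let ?T = "discriminant_mat n \<sigma>"
  have T: "?T \<in> carrier_mat (Suc n) (Suc n)"
    by (auto simp: discriminant_mat_def boundary_mat_def)
  have "transpose_mat ?T = ?T"
    using T by (auto intro!: eq_matI simp: discriminant_mat_entry less_Suc_eq_le edge_sign_def)
  then obtain \<mu> where \<mu>: "eigenvalue ?T \<mu>"
      "\<And>x. x \<in> carrier_vec (Suc n) \<Longrightarrow> x \<bullet> (?T *\<^sub>v x) \<le> \<mu> * (x \<bullet> x)"
    using symmetric_mat_eigenvalue_ge[OF T] by auto
  have fin: "finite {x. eigenvalue ?T x}"
    unfolding eigenvalue_root_char_poly[OF T]
    using degree_monic_char_poly[OF T] by (intro poly_roots_finite) auto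
  then show ?ev
    using Max_in[of "{x. eigenvalue ?T x}"] \<mu>(1) unfolding lambda_max_def by auto
  have "\<mu> \<le> lambda_max n \<sigma>" unfolding lambda_max_def using fin \<mu>(1) by (intro Max_ge) auto
  moreover have "(n + 1) - 4 * m / n \<le> \<mu> * (n + 1)"
  proof -
    let ?j = "vec (Suc n) (\<lambda>_. 1 :: real)"
    have "?j \<bullet> (?T *\<^sub>v ?j) = (\<Sum>u\<le>n. \<Sum>v\<le>n. ?T $$ (u, v))"
      using T by (simp add: scalar_prod_def lessThan_Suc_atMost atLeast0LessThan)
    also have "\<dots> = (\<Sum>u\<le>n. (n - 2 * deg u) / n)"
    proof (intro sum.cong refl)
      fix u assume "u \<in> {..n}"
      then have u: "u \<le> n" by simp
      have "(\<Sum>v\<le>n. ?T $$ (u, v)) = (\<Sum>v\<le>n. if v = u then 0 else edge_sign \<sigma> u v / n)"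
        using u by (intro sum.cong refl) (auto simp: discriminant_mat_entry)
      also have "\<dots> = (\<Sum>v\<in>{..n} - {u}. edge_sign \<sigma> u v / n)"
        using u by (intro sum.mono_neutral_cong_right) auto
      also have "\<dots> = (n - 2 * deg u) / n"
        using sum_edge_sign[OF u, of "\<lambda>_. 1"] by (simp add: sum_divide_distrib[symmetric] deg_def)
      finally show "(\<Sum>v\<le>n. ?T $$ (u, v)) = (n - 2 * deg u) / n" .
    qed
    also have "\<dots> = (n + 1) - 4 * m / n"
      using n_ge_2 sum_deg
      by (simp add: sum_divide_distrib[symmetric] sum_subtractf sum_distrib_left[symmetric] field_simps)
    finally show ?thesis using \<mu>(2)[of ?j] by (simp add: scalar_prod_def algebra_simps)
  qed
  ultimately have "(n + 1) - 4 * m / n \<le> lambda_max n \<sigma> * (n + 1)"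
    by (smt (verit) mult_right_mono of_nat_0_le_iff)
  moreover have "(1 - 4 * m / (n * (n + 1))) * (n + 1) = (n + 1) - 4 * m / n"
  proof -
    have "(1 - q / (x * y)) * y = y - q / x" if "y > 0" for q x y :: real
      using that by (simp add: left_diff_distrib)
    from this[of "n + 1" "4 * m" n] show ?thesis by (simp add: distrib_left)
  qed
  ultimately have "(1 - 4 * m / (n * (n + 1))) * real (n + 1) \<le> lambda_max n \<sigma> * real (n + 1)"
    by simp
  then show ?ge by (rule mult_right_le_imp_le) simp
qed

end

section \<open>The walk on functions of arcs\<close>

definition arc_vec :: "nat \<Rightarrow> (nat \<times> nat \<Rightarrow> real) \<Rightarrow> real vec" where
  "arc_vec n x = vec (num_arcs n) (\<lambda>i. x (arc_list n ! i))"

text \<open>The action of \<open>evolution_mat\<close> written out: because of the flip, the new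
  value at \<open>(u, v)\<close> is the reflected value at \<open>(v, u)\<close>, which involves the
  signed sum over the arcs entering \<open>u\<close>.\<close>

definition walk_step :: "nat \<Rightarrow> (nat \<times> nat \<Rightarrow> real) \<Rightarrow> (nat \<times> nat \<Rightarrow> real) \<Rightarrow> nat \<times> nat \<Rightarrow> real" where
  "walk_step n \<sigma> x = (\<lambda>(u, v).
     2 * \<sigma> (v, u) / n * (\<Sum>w\<in>{..n} - {u}. \<sigma> (w, u) * x (w, u)) - x (v, u))"

lemma arc_list_nth: "i < num_arcs n \<Longrightarrow> arc_list n ! i \<in> arcs n"
  unfolding num_arcs_def set_arc_list[symmetric] by (rule nth_mem)

lemma arc_inv_simp: "arc_inv (u, v) = (v, u)"
  by (simp add: arc_inv_def arc_target_def arc_origin_def)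

lemma arc_inv_arcs: "e \<in> arcs n \<Longrightarrow> arc_inv e \<in> arcs n"
  by (cases e) (auto simp: arc_inv_simp arcs_iff)

lemma shift_mat_arc_vec: "shift_mat n *\<^sub>v arc_vec n x = arc_vec n (x \<circ> arc_inv)"
proof (rule eq_vecI)
  fix i assume "i < dim_vec (arc_vec n (x \<circ> arc_inv))"
  then have i: "i < num_arcs n" by (simp add: arc_vec_def)
  let ?e = "arc_list n ! i"
  have "(shift_mat n *\<^sub>v arc_vec n x) $ i =
      (\<Sum>j<num_arcs n. (if ?e = arc_inv (arc_list n ! j) then 1 else 0) * x (arc_list n ! j))"
    using i by (simp add: shift_mat_def arc_vec_def scalar_prod_def atLeast0LessThan)
  also have "\<dots> = (\<Sum>b\<in>arcs n. (if ?e = arc_inv b then 1 else 0) * x b)"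
    by (rule sum_arc_list)
  also have "\<dots> = (\<Sum>b\<in>arcs n. if b = arc_inv ?e then x b else 0)"
    by (intro sum.cong refl) (auto simp: arc_inv_def arc_target_def arc_origin_def prod_eq_iff)
  also have "\<dots> = x (arc_inv ?e)"
    using arc_inv_arcs[OF arc_list_nth[OF i]] by (simp add: finite_arcs)
  finally show "(shift_mat n *\<^sub>v arc_vec n x) $ i = arc_vec n (x \<circ> arc_inv) $ i"
    using i by (simp add: arc_vec_def)
qed (simp add: shift_mat_def arc_vec_def)

lemma boundary_mat_arc_vec:
  "boundary_mat n \<sigma> *\<^sub>v arc_vec n x =
    vec (Suc n) (\<lambda>v. (\<Sum>w\<in>{..n} - {v}. \<sigma> (w, v) * x (w, v)) / sqrt n)"
    (is "_ = vec _ ?f")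
proof (rule eq_vecI)
  fix v assume "v < dim_vec (vec (Suc n) ?f)"
  then have v: "v \<le> n" by simp
  have "(boundary_mat n \<sigma> *\<^sub>v arc_vec n x) $ v = (\<Sum>i<num_arcs n.
      (if arc_target (arc_list n ! i) = v then \<sigma> (arc_list n ! i) / sqrt n else 0)
      * x (arc_list n ! i))"
    using v by (simp add: boundary_mat_def arc_vec_def scalar_prod_def atLeast0LessThan)
  also have "\<dots> = (\<Sum>e\<in>arcs n. (if arc_target e = v then \<sigma> e / sqrt n else 0) * x e)"
    by (rule sum_arc_list)
  also have "\<dots> = (\<Sum>e\<in>(\<lambda>w. (w, v)) ` ({..n} - {v}). \<sigma> e * x e / sqrt n)"
    using v by (intro sum.mono_neutral_cong_right finite_arcs) (auto simp: arcs_iff arc_target_def)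
  also have "\<dots> = ?f v"
    by (subst sum.reindex) (auto simp: inj_on_def sum_divide_distrib)
  finally show "(boundary_mat n \<sigma> *\<^sub>v arc_vec n x) $ v = vec (Suc n) ?f $ v"
    using v by simp
qed (simp add: boundary_mat_def)

lemma transpose_boundary_mat_vec:
  "transpose_mat (boundary_mat n \<sigma>) *\<^sub>v vec (Suc n) y =
    arc_vec n (\<lambda>(u, v). \<sigma> (u, v) * y v / sqrt n)" (is "_ = arc_vec n ?f")
proof (rule eq_vecI)
  fix i assume "i < dim_vec (arc_vec n ?f)"
  then have i: "i < num_arcs n" by (simp add: arc_vec_def)
  obtain a b where ab: "arc_list n ! i = (a, b)" by fastforce
  with arc_list_nth[OF i] have b: "b \<le> n" by (simp add: arcs_iff)
  have "(transpose_mat (boundary_mat n \<sigma>) *\<^sub>v vec (Suc n) y) $ i =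
      (\<Sum>v\<le>n. (if b = v then \<sigma> (a, b) / sqrt n else 0) * y v)"
    unfolding ab[symmetric] using i ab
    by (simp add: boundary_mat_def scalar_prod_def atLeast0LessThan lessThan_Suc_atMost
        arc_target_def)
  also have "\<dots> = (\<Sum>v\<le>n. if b = v then \<sigma> (a, b) / sqrt n * y v else 0)"
    by (intro sum.cong refl) auto
  also have "\<dots> = \<sigma> (a, b) * y b / sqrt n" using b by simp
  finally show "(transpose_mat (boundary_mat n \<sigma>) *\<^sub>v vec (Suc n) y) $ i = arc_vec n ?f $ i"
    using i ab by (simp add: arc_vec_def)
qed (simp add: boundary_mat_def arc_vec_def)

lemma evolution_mat_arc_vec:
  "evolution_mat n \<sigma> *\<^sub>v arc_vec n x = arc_vec n (walk_step n \<sigma> x)"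
proof -
  let ?D = "boundary_mat n \<sigma>" and ?N = "num_arcs n" and ?X = "arc_vec n x"
  have D: "?D \<in> carrier_mat (Suc n) ?N" and X: "?X \<in> carrier_vec ?N"
    and S: "shift_mat n \<in> carrier_mat ?N ?N"
    by (auto simp: boundary_mat_def arc_vec_def shift_mat_def)
  let ?y = "\<lambda>v. (\<Sum>w\<in>{..n} - {v}. \<sigma> (w, v) * x (w, v)) / sqrt n"
  have DD: "(transpose_mat ?D * ?D) *\<^sub>v ?X = arc_vec n (\<lambda>(u, v). \<sigma> (u, v) * ?y v / sqrt n)"
    using D X by (simp add: assoc_mult_mat_vec[of _ ?N "Suc n" _ ?N]
        boundary_mat_arc_vec transpose_boundary_mat_vec)
  have smult: "(2 \<cdot>\<^sub>m B) *\<^sub>v ?X = 2 \<cdot>\<^sub>v (B *\<^sub>v ?X)" if "B \<in> carrier_mat ?N ?N" for B :: "real mat"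
    using that X by (intro eq_vecI) auto
  have "(2 \<cdot>\<^sub>m (transpose_mat ?D * ?D) - 1\<^sub>m ?N) *\<^sub>v ?X =
      2 \<cdot>\<^sub>v ((transpose_mat ?D * ?D) *\<^sub>v ?X) - ?X"
    using D X by (subst minus_mult_distrib_mat_vec[of _ ?N ?N]) (auto simp: smult)
  also have "\<dots> = arc_vec n (\<lambda>(u, v). 2 * (\<sigma> (u, v) * ?y v / sqrt n) - x (u, v))"
    unfolding DD by (auto simp: arc_vec_def split: prod.split)
  also have "shift_mat n *\<^sub>v \<dots> = arc_vec n (walk_step n \<sigma> x)"
    unfolding shift_mat_arc_vec
    by (intro arg_cong[of _ _ "arc_vec n"] ext)
      (auto simp: walk_step_def arc_inv_simp)
  finally show ?thesis
    unfolding evolution_mat_def using D X S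
    by (subst assoc_mult_mat_vec[of _ ?N ?N _ ?N]) auto
qed

lemma evolution_mat_pow_arc_vec:
  "evolution_mat n \<sigma> ^\<^sub>m t *\<^sub>v arc_vec n x = arc_vec n ((walk_step n \<sigma> ^^ t) x)"
proof (induction t arbitrary: x)
  case 0
  show ?case
    by (simp add: evolution_mat_def shift_mat_def boundary_mat_def arc_vec_def)
next
  case (Suc t)
  have U: "evolution_mat n \<sigma> \<in> carrier_mat (num_arcs n) (num_arcs n)"
    by (rule carrier_matI) (simp_all add: evolution_mat_def shift_mat_def boundary_mat_def)
  have "evolution_mat n \<sigma> ^\<^sub>m Suc t *\<^sub>v arc_vec n x =
      evolution_mat n \<sigma> ^\<^sub>m t *\<^sub>v (evolution_mat n \<sigma> *\<^sub>v arc_vec n x)"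
    using U by (simp add: assoc_mult_mat_vec[OF pow_carrier_mat[OF U] U] arc_vec_def)
  then show ?case by (simp add: evolution_mat_arc_vec Suc.IH funpow_swap1)
qed

lemma walk_step_linear:
  "walk_step n \<sigma> (\<lambda>e. p * x e + q * y e) = (\<lambda>e. p * walk_step n \<sigma> x e + q * walk_step n \<sigma> y e)"
  by (auto simp: walk_step_def algebra_simps sum.distrib sum_distrib_left)

lemma walk_step_pow_linear:
  "(walk_step n \<sigma> ^^ t) (\<lambda>e. p * x e + q * y e) =
    (\<lambda>e. p * (walk_step n \<sigma> ^^ t) x e + q * (walk_step n \<sigma> ^^ t) y e)"
  by (induction t) (simp_all add: walk_step_linear)

text \<open>The relations between the functions spanning the invariant plane hold on
  \<open>arcs n\<close> only; this allows them to be substituted during an induction on the number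
  of steps.\<close>

lemma walk_step_cong:
  assumes "\<And>e. e \<in> arcs n \<Longrightarrow> x e = y e" "e \<in> arcs n"
  shows "walk_step n \<sigma> x e = walk_step n \<sigma> y e"
proof -
  obtain u v where [simp]: "e = (u, v)" by fastforce
  have "(\<Sum>w\<in>{..n} - {u}. \<sigma> (w, u) * x (w, u)) = (\<Sum>w\<in>{..n} - {u}. \<sigma> (w, u) * y (w, u))"
    using assms(2) by (intro sum.cong refl) (simp add: assms(1) arcs_iff)
  then show ?thesis using assms(2) by (simp add: walk_step_def assms(1) arcs_iff)
qed

section \<open>Norm preservation and the invariant plane\<close>

context signed_complete_graph
begin

abbreviation "step \<equiv> walk_step n \<sigma>"

text \<open>For fixed \<open>u\<close> the signs square to 1 and \<open>n\<close> arcs enter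
  \<open>u\<close>, so the square of the mean term cancels against the cross term. What remains is
  the sum of squares over reversed arcs.\<close>

lemma step_sum_squares: "(\<Sum>e\<in>arcs n. (step x e)\<^sup>2) = (\<Sum>e\<in>arcs n. (x e)\<^sup>2)"
proof -
  have "(\<Sum>v\<in>{..n} - {u}. (step x (u, v))\<^sup>2) = (\<Sum>v\<in>{..n} - {u}. (x (v, u))\<^sup>2)" if "u \<le> n" for u
  proof -
    define X where "X = (\<Sum>w\<in>{..n} - {u}. \<sigma> (w, u) * x (w, u))"
    have "(\<Sum>v\<in>{..n} - {u}. (step x (u, v))\<^sup>2) =
        (\<Sum>v\<in>{..n} - {u}. 4 * X\<^sup>2 / n\<^sup>2 - 4 * X / n * (\<sigma> (v, u) * x (v, u)) + (x (v, u))\<^sup>2)"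
    proof (intro sum.cong refl)
      fix v assume "v \<in> {..n} - {u}"
      then have sq: "\<sigma> (v, u) * \<sigma> (v, u) = 1" using that sign_square by (simp add: arcs_iff)
      have "(step x (u, v))\<^sup>2 = (\<sigma> (v, u) * \<sigma> (v, u)) * (4 * X\<^sup>2 / n\<^sup>2)
          - 4 * X / n * (\<sigma> (v, u) * x (v, u)) + (x (v, u))\<^sup>2"
        by (simp add: walk_step_def X_def[symmetric] power2_eq_square algebra_simps)
      then show "(step x (u, v))\<^sup>2 =
          4 * X\<^sup>2 / n\<^sup>2 - 4 * X / n * (\<sigma> (v, u) * x (v, u)) + (x (v, u))\<^sup>2"
        by (simp add: sq)
    qed
    also have "\<dots> = n * (4 * X\<^sup>2 / n\<^sup>2) - 4 * X / n * X + (\<Sum>v\<in>{..n} - {u}. (x (v, u))\<^sup>2)"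
      using that by (simp add: sum.distrib sum_subtractf X_def sum_distrib_left)
    also have "\<dots> = (\<Sum>v\<in>{..n} - {u}. (x (v, u))\<^sup>2)"
      using n_ge_2 by (simp add: power2_eq_square)
    finally show ?thesis .
  qed
  then have "(\<Sum>e\<in>arcs n. (step x e)\<^sup>2) = (\<Sum>(u, v)\<in>arcs n. (x (v, u))\<^sup>2)"
    by (simp add: sum_arcs)
  also have "\<dots> = (\<Sum>(u, v)\<in>arcs n. (x (u, v))\<^sup>2)" by (rule sum_arcs_swap)
  finally show ?thesis by (simp add: case_prod_unfold)
qed

lemma step_pow_sum_squares: "(\<Sum>e\<in>arcs n. ((step ^^ t) x e)\<^sup>2) = (\<Sum>e\<in>arcs n. (x e)\<^sup>2)"
  by (induction t) (simp_all add: step_sum_squares)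

text \<open>Norm preservation reduces the probability to the weight left on unmarked arcs. The walk
  runs on the constant function 1, of squared norm \<open>n * (n + 1)\<close>; linearity pulls out
  the normalising factor.\<close>

lemma finding_prob_eq:
  "finding_prob n \<sigma> =
    1 - (\<Sum>e\<in>arcs n - marked_arcs n \<sigma>. ((step ^^ search_time n \<sigma>) (\<lambda>_. 1) e)\<^sup>2) / (n * (n + 1))"
proof -
  let ?s = "1 / sqrt (num_arcs n)" and ?t = "search_time n \<sigma>"
  let ?X = "(step ^^ ?t) (\<lambda>_. 1)"
  have "uniform_vec n = arc_vec n (\<lambda>_. ?s)" by (simp add: uniform_vec_def arc_vec_def)
  then have U: "evolution_mat n \<sigma> ^\<^sub>m ?t *\<^sub>v uniform_vec n = arc_vec n (\<lambda>e. ?s * ?X e)"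
    using walk_step_pow_linear[where t = ?t and p = ?s and q = 0 and x = "\<lambda>_. 1" and y = "\<lambda>_. 1"]
    by (simp add: evolution_mat_pow_arc_vec)
  have "finding_prob n \<sigma> = (\<Sum>i<num_arcs n.
      if arc_list n ! i \<in> marked_arcs n \<sigma> then (?s * ?X (arc_list n ! i))\<^sup>2 else 0)"
    unfolding finding_prob_def U
    by (intro sum.mono_neutral_cong_left) (auto simp: arc_vec_def)
  also have "\<dots> = (\<Sum>e\<in>arcs n. if e \<in> marked_arcs n \<sigma> then (?s * ?X e)\<^sup>2 else 0)"
    by (rule sum_arc_list)
  also have "\<dots> = (\<Sum>e\<in>marked_arcs n \<sigma>. (?s * ?X e)\<^sup>2)"
    using marked_arcs_subset by (intro sum.mono_neutral_cong_right finite_arcs) auto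
  also have "\<dots> = (\<Sum>e\<in>marked_arcs n \<sigma>. (?X e)\<^sup>2) / (n * (n + 1))"
    by (simp add: power_mult_distrib power_divide num_arcs_eq sum_divide_distrib)
  also have "(\<Sum>e\<in>marked_arcs n \<sigma>. (?X e)\<^sup>2) =
      (\<Sum>e\<in>arcs n. (?X e)\<^sup>2) - (\<Sum>e\<in>arcs n - marked_arcs n \<sigma>. (?X e)\<^sup>2)"
    using sum.subset_diff[OF marked_arcs_subset finite_arcs, of "\<lambda>e. (?X e)\<^sup>2"] by simp
  finally have "finding_prob n \<sigma> = ((\<Sum>e\<in>arcs n. (?X e)\<^sup>2) -
      (\<Sum>e\<in>arcs n - marked_arcs n \<sigma>. (?X e)\<^sup>2)) / (n * (n + 1))" .
  moreover have "(\<Sum>e\<in>arcs n. (?X e)\<^sup>2) = n * (n + 1)"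
    by (simp only: step_pow_sum_squares) (simp add: card_arcs)
  moreover have "real n + real n * real n > 0" using n_ge_2 by (intro add_pos_nonneg) auto
  ultimately show ?thesis by (simp add: diff_divide_distrib distrib_left)
qed

text \<open>On arcs, \<open>step a = b\<close> since signs square to 1, and
  \<open>step b = 2 * cos \<theta> * b - a\<close> is the eigenvalue equation. This recurrence has
  the characteristic polynomial of a rotation by \<open>\<theta>\<close>; the cotangent, of order
  \<open>1 / \<theta>\<close> for small \<open>\<theta>\<close>, amplifies
  \<open>b - a\<close>.\<close>

lemma step_pow_rotation:
  fixes \<theta> :: real
  assumes f: "\<And>u. u \<le> n \<Longrightarrow> (\<Sum>v\<in>{..n} - {u}. edge_sign \<sigma> u v * f v) = n * cos \<theta> * f u"
    and \<theta>: "cos \<theta> < 1" and uv: "(u, v) \<in> arcs n"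
  shows "(step ^^ t) (\<lambda>(u, v). (\<sigma> (u, v) * f v + \<sigma> (v, u) * f u) / 2) (u, v) =
    cos (t * \<theta>) * ((\<sigma> (u, v) * f v + \<sigma> (v, u) * f u) / 2) +
    sin (t * \<theta>) * (sin \<theta> / (1 - cos \<theta>)) * ((\<sigma> (v, u) * f u - \<sigma> (u, v) * f v) / 2)"
proof -
  define a where "a = (\<lambda>(u, v). \<sigma> (u, v) * f v)"
  define b where "b = (\<lambda>(u, v). \<sigma> (v, u) * f u)"
  \<comment> \<open>\<open>\<kappa> = cot (\<theta> / 2)\<close>\<close>
  define \<kappa> where "\<kappa> = sin \<theta> / (1 - cos \<theta>)"
  \<comment> \<open>The coefficients of \<open>a\<close> and \<open>b\<close> after \<open>t\<close>
    steps: the solution of \<open>p (Suc t) = - q t\<close> and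
    \<open>q (Suc t) = p t + 2 * cos \<theta> * q t\<close> that starts with both equal to
    \<open>1 / 2\<close>.\<close>
  define p where "p t = (cos (t * \<theta>) - sin (t * \<theta>) * \<kappa>) / 2" for t :: nat
  define q where "q t = (cos (t * \<theta>) + sin (t * \<theta>) * \<kappa>) / 2" for t :: nat
  \<comment> \<open>This and \<open>\<kappa>2\<close> are half-angle identities. They make the
    brackets at \<open>cos (t * \<theta>)\<close> and \<open>sin (t * \<theta>)\<close> vanish when
    the two recurrences are checked.\<close>
  have \<kappa>1: "\<kappa> * (1 - cos \<theta>) = sin \<theta>" using \<theta> by (simp add: \<kappa>_def)
  have "\<kappa> * sin \<theta> * (1 - cos \<theta>) = \<kappa> * (1 - cos \<theta>) * sin \<theta>" by simp
  also have "\<dots> = (1 + cos \<theta>) * (1 - cos \<theta>)"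
    unfolding \<kappa>1 using sin_squared_eq[of \<theta>] by (simp add: power2_eq_square algebra_simps)
  finally have "\<kappa> * sin \<theta> * (1 - cos \<theta>) = (1 + cos \<theta>) * (1 - cos \<theta>)" .
  then have \<kappa>2: "\<kappa> * sin \<theta> = 1 + cos \<theta>" using \<theta> by simp
  have step_a: "step a e = b e" if "e \<in> arcs n" for e
  proof -
    obtain u v where e: "e = (u, v)" by fastforce
    have "(\<Sum>w\<in>{..n} - {u}. \<sigma> (w, u) * a (w, u)) = (\<Sum>w\<in>{..n} - {u}. f u)"
    proof (intro sum.cong refl)
      fix w assume "w \<in> {..n} - {u}"
      then have "\<sigma> (w, u) * \<sigma> (w, u) = 1" using that e sign_square by (simp add: arcs_iff)
      then show "\<sigma> (w, u) * a (w, u) = f u" by (simp add: a_def mult.assoc[symmetric])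
    qed
    also have "\<dots> = n * f u" using that e by (simp add: arcs_iff)
    finally show ?thesis using n_ge_2 e by (simp add: walk_step_def a_def b_def)
  qed
  have step_b: "step b e = 2 * cos \<theta> * b e - a e" if "e \<in> arcs n" for e
  proof -
    obtain u v where e: "e = (u, v)" by fastforce
    have "(\<Sum>w\<in>{..n} - {u}. \<sigma> (w, u) * b (w, u)) = n * cos \<theta> * f u"
      using f[of u] that e by (simp add: b_def edge_sign_def arcs_iff mult_ac)
    then show ?thesis using n_ge_2 e by (simp add: walk_step_def a_def b_def)
  qed
  have "(step ^^ t) (\<lambda>e. 1 / 2 * a e + 1 / 2 * b e) e = p t * a e + q t * b e"
    if "e \<in> arcs n" for e
    using that
  proof (induction t arbitrary: e)
    case (Suc t)
    have "(step ^^ Suc t) (\<lambda>e. 1 / 2 * a e + 1 / 2 * b e) e = step (\<lambda>e. p t * a e + q t * b e) e"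
      using walk_step_cong[of n _ "\<lambda>e. p t * a e + q t * b e", OF Suc.IH Suc.prems] by simp
    also have "\<dots> = (- q t) * a e + (p t + 2 * cos \<theta> * q t) * b e"
      by (simp only: walk_step_linear step_a[OF Suc.prems] step_b[OF Suc.prems])
        (simp add: algebra_simps)
    also have "- q t = p (Suc t)"
    proof -
      have "p (Suc t) + q t = 1 / 2 * (cos (t * \<theta>) * (1 + cos \<theta> - \<kappa> * sin \<theta>)
          + sin (t * \<theta>) * (\<kappa> * (1 - cos \<theta>) - sin \<theta>))"
        by (simp add: p_def q_def distrib_right cos_add sin_add field_simps)
      then show ?thesis by (simp add: \<kappa>1 \<kappa>2)
    qed
    also have "p t + 2 * cos \<theta> * q t = q (Suc t)"
    proof -
      have "p t + 2 * cos \<theta> * q t - q (Suc t) = 1 / 2 * (cos (t * \<theta>) * (1 + cos \<theta> - \<kappa> * sin \<theta>)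
          - sin (t * \<theta>) * (\<kappa> * (1 - cos \<theta>) - sin \<theta>))"
        by (simp add: p_def q_def distrib_right cos_add sin_add field_simps)
      then show ?thesis by (simp add: \<kappa>1 \<kappa>2)
    qed
    finally show ?case .
  qed (simp add: p_def q_def)
  from this[OF uv] show ?thesis
    by (simp add: a_def b_def p_def q_def \<kappa>_def case_prod_unfold add_divide_distrib diff_divide_distrib algebra_simps)
qed

end

section \<open>Searching time and finding probability\<close>

context signed_complete_graph
begin

lemma lambda_max_ge_half:
  assumes "8 * m \<le> n\<^sup>2"
  shows "lambda_max n \<sigma> \<ge> 1 / 2"
proof -
  have "real n + real n * real n > 0" using n_ge_2 by (intro add_pos_nonneg) auto
  then have "4 * m / (n * (n + 1)) \<le> 1 / 2"
    using assms by (simp add: divide_le_eq power2_eq_square algebra_simps)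
  then show ?thesis using lambda_max_ge by linarith
qed

text \<open>An eigenvalue of at least \<open>1 / 2\<close> puts \<open>\<theta>\<close> below
  \<open>pi / 3\<close>, where \<open>1 - cos \<theta>\<close> lies between
  \<open>\<theta>\<^sup>2 / 8\<close> and \<open>\<theta>\<^sup>2 / 2\<close>. The constant is
  \<open>96 = 8 * 12\<close>, and 10 exceeds its square root.\<close>

lemma theta_max_bounds:
  assumes half: "lambda_max n \<sigma> \<ge> 1 / 2"
    and gap: "m / n\<^sup>2 \<le> 1 - lambda_max n \<sigma>" "1 - lambda_max n \<sigma> \<le> 12 * m / n\<^sup>2"
  defines "\<theta> \<equiv> theta_max n \<sigma>"
  shows "cos \<theta> = lambda_max n \<sigma>" "0 < \<theta>" "\<theta> \<le> pi / 3"
    and "sqrt m / n \<le> \<theta>" "\<theta> \<le> 10 * sqrt m / n" "\<theta>\<^sup>2 \<le> 96 * m / n\<^sup>2"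
proof -
  let ?l = "lambda_max n \<sigma>"
  have npos: "real n > 0" using n_ge_2 by simp
  have "m / n\<^sup>2 > 0" using m_ge_1 npos by simp
  then have l1: "?l < 1" using gap by linarith
  show cos: "cos \<theta> = ?l" using half l1 by (simp add: \<theta>_def theta_max_def)
  have \<theta>0: "0 \<le> \<theta>" using half l1 by (simp add: \<theta>_def theta_max_def arccos_lbound)
  have "\<theta> \<noteq> 0" using cos l1 by auto
  then show pos: "0 < \<theta>" using \<theta>0 by simp
  have "arccos ?l \<le> arccos (1 / 2)" using half l1 by (intro arccos_le_arccos) auto
  also have "arccos (1 / 2 :: real) = pi / 3" using arccos_cos[of "pi / 3"] by (simp add: cos_60)
  finally show le: "\<theta> \<le> pi / 3" by (simp add: \<theta>_def theta_max_def)
  show sq: "\<theta>\<^sup>2 \<le> 96 * m / n\<^sup>2" using one_minus_cos_ge[OF \<theta>0 le] gap(2) cos by simp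
  also have "\<dots> \<le> (10 * sqrt m / n)\<^sup>2"
    using npos by (simp add: power_divide power_mult_distrib divide_right_mono)
  finally show "\<theta> \<le> 10 * sqrt m / n" by (rule power2_le_imp_le) simp
  have "(sqrt m / n)\<^sup>2 = m / n\<^sup>2" by (simp add: power_divide)
  also have "\<dots> \<le> \<theta>\<^sup>2"
    using one_minus_cos_le[of \<theta>] gap(1) cos zero_le_power2[of \<theta>] by linarith
  finally show "sqrt m / n \<le> \<theta>" by (rule power2_le_imp_le) (rule \<theta>0)
qed

text \<open>Rounding down loses less than one step, so
  \<open>search_time n \<sigma> * \<theta>\<close> falls short of \<open>pi / 2\<close> by at most
  \<open>\<theta>\<close>. The bound \<open>\<theta> \<le> pi / 3\<close> ensures that the rounded
  quotient is at least 1.\<close>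

lemma search_time_bounds:
  fixes \<theta> :: real
  assumes \<theta>: "theta_max n \<sigma> = \<theta>" "0 < \<theta>" "\<theta> \<le> pi / 3"
  shows "search_time n \<sigma> \<le> pi / (2 * \<theta>)" "pi / (4 * \<theta>) \<le> search_time n \<sigma>"
    and "\<bar>cos (search_time n \<sigma> * \<theta>)\<bar> \<le> \<theta>"
proof -
  let ?x = "pi / (2 * \<theta>)" and ?t = "real (search_time n \<sigma>)"
  have x: "?x \<ge> 1" using \<theta> pi_gt_zero by (simp add: le_divide_eq)
  then have t: "?t = of_int \<lfloor>?x\<rfloor>" using \<theta>(1) by (simp add: search_time_def)
  show up: "?t \<le> ?x" by (simp add: t)
  show "pi / (4 * \<theta>) \<le> ?t" using half_le_floor[OF x] unfolding t by simp
  have "?t * \<theta> \<le> ?x * \<theta>" using up \<theta>(2) by (intro mult_right_mono) auto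
  then have u: "?t * \<theta> \<le> pi / 2" using \<theta>(2) by simp
  have "(?x - 1) * \<theta> \<le> ?t * \<theta>" using \<theta>(2) unfolding t by (intro mult_right_mono) linarith+
  then have l: "pi / 2 - \<theta> \<le> ?t * \<theta>" using \<theta>(2) by (simp add: left_diff_distrib)
  have "\<bar>cos (?t * \<theta>)\<bar> = \<bar>sin (pi / 2 - ?t * \<theta>)\<bar>" by (simp add: sin_diff)
  also have "\<dots> \<le> \<bar>pi / 2 - ?t * \<theta>\<bar>" by (rule abs_sin_x_le_abs_x)
  also have "\<dots> \<le> \<theta>" using u l by simp
  finally show "\<bar>cos (?t * \<theta>)\<bar> \<le> \<theta>" .
qed

text \<open>Every vertex is the origin of \<open>n\<close> arcs and the target of \<open>n\<close>
  arcs.\<close>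

lemma sum_arcs_endpoints:
  fixes h :: "nat \<Rightarrow> real"
  shows "(\<Sum>(u, v)\<in>arcs n. (h u + h v) / 2) = n * (\<Sum>u\<le>n. h u)"
proof -
  have "(\<Sum>(u, v)\<in>arcs n. h u) = n * (\<Sum>u\<le>n. h u)"
    unfolding sum_arcs by (simp add: sum_distrib_left)
  moreover have "(\<Sum>(u, v)\<in>arcs n. h v) = (\<Sum>(u, v)\<in>arcs n. h u)" by (rule sum_arcs_swap)
  ultimately show ?thesis
    by (simp add: case_prod_unfold sum_divide_distrib[symmetric] sum.distrib)
qed

text \<open>The constant 1 splits into \<open>A\<close>, which rotates in the invariant plane, and a
  remainder \<open>r\<close> controlled by norm preservation alone. The three summands bound the
  cosine part, the sine part and the remainder; the factor 3 comes from squaring a sum of three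
  terms, and \<open>9 / 4\<close> from \<open>\<bar>A e\<bar> \<le> 3 / 2\<close>.\<close>

lemma unmarked_weight_le:
  fixes \<theta> G :: real and f :: "nat \<Rightarrow> real"
  assumes f: "\<And>u. u \<le> n \<Longrightarrow> (\<Sum>v\<in>{..n} - {u}. edge_sign \<sigma> u v * f v) = n * cos \<theta> * f u"
    and range: "\<And>u. u \<le> n \<Longrightarrow> 1 / 2 \<le> f u \<and> f u \<le> 3 / 2" and \<theta>: "cos \<theta> < 1"
  defines "G \<equiv> \<Sum>u\<le>n. (1 - f u)\<^sup>2"
  shows "(\<Sum>e\<in>arcs n - marked_arcs n \<sigma>. ((step ^^ t) (\<lambda>_. 1) e)\<^sup>2) \<le>
    3 * ((cos (t * \<theta>))\<^sup>2 * (9 / 4) * (n * (n + 1)) + (1 + cos \<theta>) / (1 - cos \<theta>) * (n * G)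
      + (n * G + 14 * m))"
proof -
  define A where "A = (\<lambda>(u, v). (\<sigma> (u, v) * f v + \<sigma> (v, u) * f u) / 2)"
  define B where "B = (\<lambda>(u, v). (\<sigma> (v, u) * f u - \<sigma> (u, v) * f v) / 2)"
  define r where "r e = 1 - A e" for e
  define \<kappa> where "\<kappa> = sin \<theta> / (1 - cos \<theta>)"
  let ?X = "(step ^^ t) (\<lambda>_. 1)" and ?R = "(step ^^ t) r" and ?O = "arcs n - marked_arcs n \<sigma>"
  \<comment> \<open>On unmarked arcs \<open>B\<close> and \<open>r\<close> are half the difference
    and half the sum of the endpoint deficits, so \<open>H\<close> majorises both squares.\<close>
  define H where "H = (\<lambda>(u, v). ((1 - f u)\<^sup>2 + (1 - f v)\<^sup>2) / 2)"
  have H_sum: "(\<Sum>e\<in>arcs n. H e) = n * G" unfolding H_def G_def by (rule sum_arcs_endpoints)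
  have H_nonneg: "0 \<le> H e" for e by (simp add: H_def case_prod_unfold)
  have X: "?X e = cos (t * \<theta>) * A e + sin (t * \<theta>) * \<kappa> * B e + ?R e" if "e \<in> arcs n" for e
  proof -
    have "(\<lambda>_. 1) = (\<lambda>e. 1 * A e + 1 * r e)" by (simp add: r_def)
    then have "?X e = (step ^^ t) A e + ?R e"
      by (simp only: walk_step_pow_linear)
    moreover have "(step ^^ t) A e = cos (t * \<theta>) * A e + sin (t * \<theta>) * \<kappa> * B e"
      using step_pow_rotation[OF f \<theta>] that by (cases e) (simp add: A_def B_def \<kappa>_def)
    ultimately show ?thesis by simp
  qed
  have A_unmarked: "A (u, v) = (f u + f v) / 2" and B_unmarked: "B (u, v) = (f u - f v) / 2"
    if "(u, v) \<in> ?O" for u v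
    using unmarked_sign[of u v] that by (auto simp: A_def B_def)
  have A_sq: "(A e)\<^sup>2 \<le> 9 / 4" if "e \<in> ?O" for e
  proof -
    obtain u v where e: "e = (u, v)" by fastforce
    have uv: "u \<le> n" "v \<le> n" using that e by (auto simp: arcs_iff)
    have "\<bar>A e\<bar> \<le> \<bar>3 / 2\<bar>"
      using A_unmarked[of u v] range[OF uv(1)] range[OF uv(2)] that e by simp
    then have "(A e)\<^sup>2 \<le> (3 / 2)\<^sup>2" by (simp only: abs_le_square_iff)
    then show ?thesis by (simp add: power_divide)
  qed
  have B_sq: "(B e)\<^sup>2 \<le> H e" if "e \<in> ?O" for e
  proof -
    obtain u v where e: "e = (u, v)" by fastforce
    have "B e = ((1 - f v) - (1 - f u)) / 2" using B_unmarked[of u v] that e by simp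
    then show ?thesis
      using half_diff_square_le[of "1 - f v" "1 - f u"] by (simp only: H_def e split add.commute)
  qed
  have r_sq: "(r e)\<^sup>2 \<le> H e + 7 * of_bool (e \<in> marked_arcs n \<sigma>)" if "e \<in> arcs n" for e
  proof -
    obtain u v where e: "e = (u, v)" by fastforce
    have uv: "(u, v) \<in> arcs n" "(v, u) \<in> arcs n" "u \<le> n" "v \<le> n"
      using that e by (auto simp: arcs_iff)
    show ?thesis
    proof (cases "e \<in> marked_arcs n \<sigma>")
      case True
      \<comment> \<open>On marked arcs \<open>A\<close> need not be near 1. The crude bound
        \<open>25 / 4 \<le> 7\<close> suffices, and the \<open>2 * m\<close> marked arcs contribute
        \<open>14 * m\<close>.\<close>
      have "\<bar>A e\<bar> \<le> 3 / 2"
        using sign_cases[OF uv(1)] sign_cases[OF uv(2)] range[OF uv(3)] range[OF uv(4)] e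
        by (auto simp: A_def)
      then have "\<bar>r e\<bar> \<le> \<bar>5 / 2\<bar>" unfolding r_def by linarith
      then have "(r e)\<^sup>2 \<le> (5 / 2)\<^sup>2" by (simp only: abs_le_square_iff)
      also have "\<dots> \<le> 7" by (simp add: power_divide)
      finally show ?thesis using True H_nonneg[of e] by simp
    next
      case False
      then have "r e = ((1 - f u) + (1 - f v)) / 2"
        using A_unmarked[of u v] that e by (simp add: r_def)
      then show ?thesis
        using False half_sum_square_le[of "1 - f u" "1 - f v"] by (simp only: H_def e split) simp
    qed
  qed
  have \<kappa>: "\<kappa>\<^sup>2 = (1 + cos \<theta>) / (1 - cos \<theta>)"
  proof -
    have "(sin \<theta>)\<^sup>2 = (1 + cos \<theta>) * (1 - cos \<theta>)"
      using sin_squared_eq[of \<theta>] by (simp add: power2_eq_square algebra_simps)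
    then show ?thesis using \<theta> by (simp add: \<kappa>_def power_divide power2_eq_square)
  qed
  have pt: "(?X e)\<^sup>2 \<le> 3 * ((cos (t * \<theta>))\<^sup>2 * (9 / 4) + \<kappa>\<^sup>2 * H e + (?R e)\<^sup>2)" if "e \<in> ?O" for e
  proof -
    have "(?X e)\<^sup>2 \<le> 3 * ((cos (t * \<theta>) * A e)\<^sup>2 + (sin (t * \<theta>) * \<kappa> * B e)\<^sup>2 + (?R e)\<^sup>2)"
      using X[of e] that square_sum3_le by simp
    moreover have "(cos (t * \<theta>) * A e)\<^sup>2 \<le> (cos (t * \<theta>))\<^sup>2 * (9 / 4)"
      unfolding power_mult_distrib using A_sq[OF that] by (intro mult_left_mono) auto
    moreover have "(sin (t * \<theta>) * \<kappa> * B e)\<^sup>2 \<le> \<kappa>\<^sup>2 * H e"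
    proof -
      have "(sin (t * \<theta>))\<^sup>2 \<le> 1" using sin_squared_eq[of "t * \<theta>"] by simp
      then have "(sin (t * \<theta>))\<^sup>2 * (\<kappa>\<^sup>2 * (B e)\<^sup>2) \<le> 1 * (\<kappa>\<^sup>2 * (B e)\<^sup>2)"
        by (intro mult_right_mono) auto
      also have "\<dots> \<le> \<kappa>\<^sup>2 * H e" using B_sq[OF that] by (simp add: mult_left_mono)
      finally show ?thesis by (simp add: power_mult_distrib mult.assoc)
    qed
    ultimately show ?thesis by (smt (verit))
  qed
  have "(\<Sum>e\<in>?O. (?X e)\<^sup>2) \<le> (\<Sum>e\<in>?O. 3 * ((cos (t * \<theta>))\<^sup>2 * (9 / 4) + \<kappa>\<^sup>2 * H e + (?R e)\<^sup>2))"
    by (intro sum_mono pt)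
  \<comment> \<open>The sum is enlarged to all arcs so that norm preservation replaces the evolved
    remainder by \<open>r\<close> itself.\<close>
  also have "\<dots> \<le> (\<Sum>e\<in>arcs n. 3 * ((cos (t * \<theta>))\<^sup>2 * (9 / 4) + \<kappa>\<^sup>2 * H e + (?R e)\<^sup>2))"
    using H_nonneg by (intro sum_mono2 finite_arcs) auto
  also have "\<dots> = 3 * ((cos (t * \<theta>))\<^sup>2 * (9 / 4) * (n * (n + 1)) + \<kappa>\<^sup>2 * (n * G)
      + (\<Sum>e\<in>arcs n. (r e)\<^sup>2))"
    by (simp only: sum_distrib_left[symmetric] sum.distrib step_pow_sum_squares H_sum)
      (simp add: card_arcs)
  also have "(\<Sum>e\<in>arcs n. (r e)\<^sup>2) \<le> (\<Sum>e\<in>arcs n. H e + 7 * of_bool (e \<in> marked_arcs n \<sigma>))"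
    by (intro sum_mono r_sq)
  also have "\<dots> = n * G + 14 * m"
    using marked_arcs_subset finite_arcs card_marked_arcs
    by (simp add: sum.distrib H_sum sum_distrib_left[symmetric] Int_absorb1 Int_commute)
  finally show ?thesis by (simp add: \<kappa>)
qed

text \<open>The condition \<open>c \<le> 1 / 32\<close> gives \<open>8 * m \<le> n\<^sup>2\<close>,
  hence a top eigenvalue of at least \<open>1 / 2\<close>, and \<open>16 * k \<le> n\<close>. The
  error terms are then all bounded by multiples of \<open>c\<close>.\<close>

lemma search_succeeds:
  fixes c :: real
  assumes k: "k \<le> c * (n + 1)" and m: "m \<le> c * n\<^sup>2" and c: "c \<le> 1 / 32"
  shows "1 / 20 * (n / sqrt m) \<le> search_time n \<sigma>"
    and "search_time n \<sigma> \<le> 2 * (n / sqrt m)"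
    and "finding_prob n \<sigma> \<ge> 1 - 2000 * c"
proof -
  define l where "l = lambda_max n \<sigma>"
  define \<theta> where "\<theta> = theta_max n \<sigma>"
  have npos: "real n > 0" using n_ge_2 by simp
  have sqm: "sqrt m > 0" using m_ge_1 by simp
  have "c * n\<^sup>2 \<le> 1 / 32 * n\<^sup>2" using c by (intro mult_right_mono) auto
  with m have "8 * m \<le> n\<^sup>2" by linarith
  from lambda_max_ge_half[OF this] have half: "l \<ge> 1 / 2" by (simp add: l_def)
  have "c * (n + 1) \<le> 1 / 32 * (n + 1)" using c by (intro mult_right_mono) auto
  with k have "k \<le> 1 / 32 * (n + 1)" by (rule order_trans)
  then have k16: "16 * k \<le> n" using n_ge_2 by simp
  obtain f where f: "\<And>u. u \<le> n \<Longrightarrow> (\<Sum>v\<in>{..n} - {u}. edge_sign \<sigma> u v * f v) = n * l * f u"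
    and near: "\<And>u. u \<le> n \<Longrightarrow> \<bar>1 - f u\<bar> \<le> 8 * deg u / n"
    and range: "\<And>u. u \<le> n \<Longrightarrow> 1 / 2 \<le> f u \<and> f u \<le> 3 / 2"
    and gap: "m / n\<^sup>2 \<le> 1 - l" "1 - l \<le> 12 * m / n\<^sup>2"
    by (rule discriminant_top_eigenfunction[OF lambda_max_eigenvalue half[unfolded l_def] k16,
          folded l_def]) blast
  note \<theta> = theta_max_bounds[OF half[unfolded l_def] gap[unfolded l_def], folded \<theta>_def l_def]
  note t = search_time_bounds[OF \<theta>_def[symmetric] \<theta>(2,3)]
  \<comment> \<open>The bounds \<open>\<theta> \<le> 10 * sqrt m / n\<close> and
    \<open>pi \<ge> 2\<close> produce \<open>1 / 20\<close>; below,
    \<open>sqrt m / n \<le> \<theta>\<close> and \<open>pi < 4\<close> produce 2.\<close>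
  have "1 / 20 * (n / sqrt m) \<le> pi / 40 * (n / sqrt m)"
    using pi_ge_two by (intro mult_right_mono) auto
  also have "\<dots> = pi / (4 * (10 * sqrt m / n))" using npos sqm by (simp add: field_simps)
  also have "\<dots> \<le> pi / (4 * \<theta>)" using \<theta>(2,5) by (intro frac_le) auto
  also have "\<dots> \<le> search_time n \<sigma>" by (rule t(2))
  finally show "1 / 20 * (n / sqrt m) \<le> search_time n \<sigma>" .
  have "search_time n \<sigma> \<le> pi / (2 * \<theta>)" by (rule t(1))
  also have "\<dots> \<le> pi / (2 * (sqrt m / n))"
    using \<theta>(4) npos sqm by (intro frac_le) auto
  also have "\<dots> = pi / 2 * (n / sqrt m)" using npos sqm by (simp add: field_simps)
  also have "\<dots> \<le> 2 * (n / sqrt m)"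
    using pi_less_4 by (intro mult_right_mono) auto
  finally show "search_time n \<sigma> \<le> 2 * (n / sqrt m)" .
  define G where "G = (\<Sum>u\<le>n. (1 - f u)\<^sup>2)"
  \<comment> \<open>One factor \<open>deg u\<close> of the square is bounded by \<open>k\<close>;
    the other sums to \<open>2 * m\<close>.\<close>
  have G: "G \<le> 128 * k * m / n\<^sup>2"
  proof -
    have "G \<le> (\<Sum>u\<le>n. 64 / n\<^sup>2 * k * deg u)"
      unfolding G_def
    proof (intro sum_mono)
      fix u assume "u \<in> {..n}"
      then have "\<bar>1 - f u\<bar>\<^sup>2 \<le> (8 * deg u / n)\<^sup>2" using near by (intro power_mono) auto
      then have "(1 - f u)\<^sup>2 \<le> 64 / n\<^sup>2 * (deg u * deg u)"
        by (simp add: power_divide power_mult_distrib) (simp add: power2_eq_square)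
      also have "\<dots> \<le> 64 / n\<^sup>2 * (k * deg u)"
        using deg_le deg_nonneg by (intro mult_left_mono mult_right_mono) auto
      finally show "(1 - f u)\<^sup>2 \<le> 64 / n\<^sup>2 * k * deg u" by simp
    qed
    also have "\<dots> = 128 * k * m / n\<^sup>2"
      unfolding sum_distrib_left[symmetric] sum_deg by simp
    finally show ?thesis .
  qed
  have c0: "c \<ge> 0"
  proof (rule ccontr)
    assume "\<not> c \<ge> 0"
    then have "c * n\<^sup>2 \<le> 0" by (intro mult_nonpos_nonneg) auto
    then show False using m m_ge_1 by linarith
  qed
  have mn: "m / n\<^sup>2 \<le> c" using m npos by (simp add: divide_le_eq)
  have c_sq: "c * c \<le> c" using c c0 by (intro mult_left_le) auto
  have kn: "k / (n + 1) \<le> c" using k by (simp add: divide_le_eq)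
  have mpos: "m > 0" using m_ge_1 by linarith
  have mn0: "m / n\<^sup>2 > 0" using mpos npos by simp
  then have l1: "l < 1" using gap(1) by linarith
  have G0: "G \<ge> 0" by (simp add: G_def sum_nonneg)
  have Gn: "n * G / (n * (n + 1)) \<le> 128 * (m / n\<^sup>2) * (k / (n + 1))"
  proof -
    have "n * G / (n * (n + 1)) = G / (n + 1)"
      using npos by (simp only: of_nat_mult mult_divide_mult_cancel_left_if) simp
    also have "\<dots> \<le> 128 * k * m / n\<^sup>2 / (n + 1)" using G by (rule divide_right_mono) simp
    also have "\<dots> = 128 * (m / n\<^sup>2) * (k / (n + 1))" by simp
    finally show ?thesis .
  qed
  \<comment> \<open>The constant is \<open>216 = 96 * 9 / 4\<close>.\<close>
  have t1: "(cos (search_time n \<sigma> * \<theta>))\<^sup>2 * (9 / 4) \<le> 216 * c"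
  proof -
    have "(cos (search_time n \<sigma> * \<theta>))\<^sup>2 \<le> \<theta>\<^sup>2"
      using t(3) \<theta>(2) abs_le_square_iff[of "cos (search_time n \<sigma> * \<theta>)" \<theta>] by simp
    then show ?thesis using \<theta>(6) mn by simp
  qed
  \<comment> \<open>The decisive cancellation: the squared cotangent may be as large as
    \<open>2 * n\<^sup>2 / m\<close>, while the mean square deviation of \<open>f\<close> carries a
    factor \<open>m / n\<^sup>2\<close>. Only the proportion of marked vertices survives.\<close>
  have t2: "(1 + l) / (1 - l) * (n * G / (n * (n + 1))) \<le> 256 * c"
  proof -
    have "(1 + l) / (1 - l) \<le> 2 / (m / n\<^sup>2)"
      using l1 half gap(1) mn0 by (intro frac_le) auto
    then have "(1 + l) / (1 - l) * (n * G / (n * (n + 1))) \<le>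
        2 / (m / n\<^sup>2) * (128 * (m / n\<^sup>2) * (k / (n + 1)))"
      using Gn G0 by (intro mult_mono) auto
    also have "\<dots> = 256 * (k / (n + 1))" using mpos npos by simp
    finally show ?thesis using kn by linarith
  qed
  have t3: "(n * G + 14 * m) / (n * (n + 1)) \<le> 142 * c"
  proof -
    have "128 * (m / n\<^sup>2) * (k / (n + 1)) \<le> 128 * c * c"
      using mn kn c0 by (intro mult_mono) auto
    moreover have "14 * m / (n * (n + 1)) \<le> 14 * m / n\<^sup>2"
      using npos by (intro frac_le) (auto simp: power2_eq_square)
    ultimately show ?thesis
      using Gn mn c_sq unfolding add_divide_distrib by linarith
  qed
  have "(\<Sum>e\<in>arcs n - marked_arcs n \<sigma>. ((step ^^ search_time n \<sigma>) (\<lambda>_. 1) e)\<^sup>2) / (n * (n + 1))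
      \<le> 3 * ((cos (search_time n \<sigma> * \<theta>))\<^sup>2 * (9 / 4) * (n * (n + 1))
        + (1 + l) / (1 - l) * (n * G) + (n * G + 14 * m)) / (n * (n + 1))"
    using unmarked_weight_le[of f \<theta> "search_time n \<sigma>"] f range l1 \<theta>(1) unfolding G_def[symmetric]
    by (intro divide_right_mono) auto
  also have "\<dots> = 3 * ((cos (search_time n \<sigma> * \<theta>))\<^sup>2 * (9 / 4)
      + (1 + l) / (1 - l) * (n * G / (n * (n + 1))) + (n * G + 14 * m) / (n * (n + 1)))"
  proof -
    have cancel: "3 * (x * N + y * z + w) / N = 3 * (x + y * (z / N) + w / N)" if "N > 0" for x y z w N :: real
      using that by (simp add: field_simps)
    show ?thesis by (rule cancel, unfold of_nat_0_less_iff) (use n_ge_2 in simp)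
  qed
  \<comment> \<open>Here \<open>3 * (216 + 256 + 142) = 1842\<close>.\<close>
  also have "\<dots> \<le> 2000 * c" using t1 t2 t3 c0 by (smt (verit))
  finally show "finding_prob n \<sigma> \<ge> 1 - 2000 * c" unfolding finding_prob_eq by linarith
qed

end

section \<open>Choice of the constants\<close>

theorem corollary4p10:
  fixes \<epsilon> :: real
  assumes "\<epsilon> > 0"
  shows "\<exists>c c\<^sub>1 c\<^sub>2 :: real. c > 0 \<and> 0 < c\<^sub>1 \<and> c\<^sub>1 \<le> c\<^sub>2 \<and>
    (\<forall>(n :: nat) (\<sigma> :: nat \<times> nat \<Rightarrow> real).
       n \<ge> 2 \<and> admissible n \<sigma> \<and>
       real (card (marked_verts n \<sigma>)) / real (card (verts n)) +
         real (card (marked_edges n \<sigma>)) / real (card (edges n)) < c \<longrightarrow>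
       c\<^sub>1 * (real n / sqrt (real (card (marked_edges n \<sigma>)))) \<le> real (search_time n \<sigma>) \<and>
       real (search_time n \<sigma>) \<le> c\<^sub>2 * (real n / sqrt (real (card (marked_edges n \<sigma>)))) \<and>
       finding_prob n \<sigma> \<ge> 1 - \<epsilon>)"
proof -
  \<comment> \<open>Only \<open>c\<close> depends on \<open>\<epsilon>\<close>; the constants for
    the searching time are \<open>1 / 20\<close> and 2 throughout.\<close>
  define c where "c = min (\<epsilon> / 2000) (1 / 32)"
  have c: "c > 0" "c \<le> 1 / 32" "2000 * c \<le> \<epsilon>" using assms by (auto simp: c_def min_def)
  have main: "1 / 20 * (real n / sqrt (real (card (marked_edges n \<sigma>)))) \<le> real (search_time n \<sigma>) \<and>
       real (search_time n \<sigma>) \<le> 2 * (real n / sqrt (real (card (marked_edges n \<sigma>)))) \<and>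
       finding_prob n \<sigma> \<ge> 1 - \<epsilon>"
    if n: "n \<ge> 2" and adm: "admissible n \<sigma>"
      and small: "real (card (marked_verts n \<sigma>)) / real (card (verts n)) +
         real (card (marked_edges n \<sigma>)) / real (card (edges n)) < c" for n \<sigma>
  proof -
    interpret signed_complete_graph n \<sigma> using n adm by unfold_locales
    have E2: "2 * real (card (edges n)) = real n * (real n + 1)"
      using arg_cong[OF card_edges[of n], of real] by (simp add: distrib_left)
    moreover have "real n * (real n + 1) > 0" using n by simp
    ultimately have E: "real (card (edges n)) > 0" by linarith
    \<comment> \<open>The complete graph has \<open>n * (n + 1) / 2 \<le> n\<^sup>2\<close> edges,
      so a proportion below \<open>c\<close> means at most \<open>c * n\<^sup>2\<close> marked
      edges.\<close>
    have "real n * 1 \<le> real n * real n" using n by (intro mult_left_mono) auto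
    then have "real (card (edges n)) \<le> real n ^ 2"
      using E2 by (simp add: power2_eq_square distrib_left)
    then have cE: "c * real (card (edges n)) \<le> c * real n ^ 2" using c by (intro mult_left_mono) auto
    have V: "real (card (verts n)) = n + 1" by (simp add: verts_def)
    have "k / (n + 1) \<ge> 0" "m / real (card (edges n)) \<ge> 0" by simp_all
    then have "k / (n + 1) \<le> c" "m / real (card (edges n)) \<le> c"
      using small unfolding V by linarith+
    then have "k \<le> c * (n + 1)" "m \<le> c * n\<^sup>2"
      using E cE by (simp_all add: divide_le_eq)
    from search_succeeds[OF this c(2)] show ?thesis using c(3) by simp
  qed
  show ?thesis
    using c(1) main by (intro exI[of _ c] exI[of _ "1 / 20"] exI[of _ 2]) auto
qed

end
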